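(* Let $X$ be a nondeterministic two-parameter Lévy process on $\mathbb{R}^d$ with exponent $\psi$, and let $\alpha(t)=(x(t),y(t))_{t\in T}$ be a decreasing path. Consider the following four conditions on $\alpha$, together with the associated function $\varphi$ on $D=\{t-s: s,t\in T,\ t>s\}$: (i) $x(t)=a,\ y(t)=b-ct$ for all $t\in T$, or $x(t)=b+ct,\ y(t)=a$ for all $t\in T$, for some $b\in\mathbb{R}$ and constants $a,c>0$; here $\varphi(u)=acu$. (ii) $x(t)=a+d(t-s^* )\mathbf{1}_{\{t>s^*\}}$, $y(t)=b-c(t-s^* )\mathbf{1}_{\{t\le s^*\}}$ for $t\in T$, for some $s^*\in T^\circ$ and constants $a,b,c,d>0$ with $ac=bd$; here $\varphi(u)=acu$. (iii) $x(t)=a+bt,\ y(t)=c-dt$ for $t\in T$, for some $a,c\in\mathbb{R}$ and constants $b,d>0$; here $\varphi(u)=(ad+bc)u-bdu^2$. (iv) $x(t)=ae^{ct},\ y(t)=be^{-ct}$ for $t\in T$, for some constants $a,b,c>0$; here $\varphi(u)=2ab(1-e^{-cu})$. If $X$ is symmetric, then the process $X^\alpha$ has stationary increments if and only if $\alpha$ satisfies one of (i)–(iv), and in each of these cases $$E\big[e^{i\langle z,X^\alpha_t-X^\alpha_s\rangle}\big]=\exp[\varphi(t-s)\psi(z)],\quad z\in\mathbb{R}^d,\ s,t\in T,\ s<t.$$ If $X$ is not symmetric, then $X^\alpha$ has stationary increments if and only if $\alpha$ satisfies (i) or (iv), and under (iv) $$E\big[e^{i\langle z,X^\alpha_t-X^\alpha_s\rangle}\big]=\exp\Big[\varphi(t-s)\frac{\psi(z)+\psi(-z)}{2}\Big],\quad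 z\in\mathbb{R}^d,\ s,t\in T,\ s<t.$$
   Context: For $s,t\in\mathbb{R}_+^2$ with $s_1\le t_1$, $s_2\le t_2$, the rectangle $(s,t]$ is $(s_1,t_1]\times(s_2,t_2]$, and the increment of a function/process $X$ over it is $X((s,t])=X_{t_1,t_2}-X_{s_1,t_2}-X_{t_1,s_2}+X_{s_1,s_2}$. A two-parameter Lévy process (TPLP) on $\mathbb{R}^d$ is an $\mathbb{R}^d$-valued process $X=\{X_t:t\in\mathbb{R}_+^2\}$ such that: increments over finitely many disjoint rectangles are independent; $X(B)$ and $X(B+p)$ have the same law for every rectangle $B$ and $p\in\mathbb{R}_+^2$; $X$ vanishes on the axes a.s.; $X$ is continuous in probability; and its sample paths are a.s. right continuous with quadrantal limits. For such $X$ there is a unique Lévy–Khintchine exponent $\psi:\mathbb{R}^d\to\mathbb{C}$ (the exponent of $X$) with $E[e^{i\langle z,X(B)\rangle}]=e^{m(B)\psi(z)}$ for every rectangle $B$, where $m$ is Lebesgue measure. $X$ is nondeterministic if $X_{1,1}$ is not a.s. constant, and symmetric if $X$ and $-X$ have the same law. $T\subseteq\mathbb{R}$ is an interval with interior $T^\circ$. A decreasing path is $\alpha(t)=(x(t),y(t))_{t\in T}$ with $x$ nondecreasing and $y$ nonincreasing continuous functions on $T$, both strictly positive on $T^\circ$, at least one not identically constant. The TPLP $X$ along $\alpha$ is the one-parameter process $X^\alpha=\{X_{x(t),y(t)}:t\in T\}$. *)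

theory Defs
  imports "HOL-Probability.Probability"
begin

definition quad :: "(real \<times> real) set" where
  "quad = {p. 0 \<le> fst p \<and> 0 \<le> snd p}"

definition is_rect :: "real \<times> real \<Rightarrow> real \<times> real \<Rightarrow> bool" where
  "is_rect s t \<longleftrightarrow> s \<in> quad \<and> fst s \<le> fst t \<and> snd s \<le> snd t"

definition rect_set :: "real \<times> real \<Rightarrow> real \<times> real \<Rightarrow> (real \<times> real) set" where
  "rect_set s t = {fst s<..fst t} \<times> {snd s<..snd t}"

definition rect_area :: "real \<times> real \<Rightarrow> real \<times> real \<Rightarrow> real" where
  "rect_area s t = (fst t - fst s) * (snd t - snd s)"

definition incr :: "(real \<times> real \<Rightarrow> 'a \<Rightarrow> 'v::real_vector) \<Rightarrow> real \<times> real \<Rightarrow> real \<times> real \<Rightarrow> 'a \<Rightarrow> 'v" where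
  "incr X s t \<omega> = X (fst t, snd t) \<omega> - X (fst s, snd t) \<omega> - X (fst t, snd s) \<omega> + X (fst s, snd s) \<omega>"

definition rcql :: "(real \<times> real \<Rightarrow> 'v::topological_space) \<Rightarrow> bool" where
  "rcql f \<longleftrightarrow> (\<forall>t\<in>quad.
      continuous (at t within {s\<in>quad. fst t \<le> fst s \<and> snd t \<le> snd s}) f \<and>
      (\<exists>l. (f \<longlongrightarrow> l) (at t within {s\<in>quad. fst t \<le> fst s \<and> snd s < snd t})) \<and>
      (\<exists>l. (f \<longlongrightarrow> l) (at t within {s\<in>quad. fst s < fst t \<and> snd t \<le> snd s})) \<and>
      (\<exists>l. (f \<longlongrightarrow> l) (at t within {s\<in>quad. fst s < fst t \<and> snd s < snd t})))"

definition TPLP :: "'a measure \<Rightarrow> (real \<times> real \<Rightarrow> 'a \<Rightarrow> 'v::euclidean_space) \<Rightarrow> bool" where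
  "TPLP M X \<longleftrightarrow> prob_space M \<and>
     (\<forall>t. X t \<in> borel_measurable M) \<and>
     \<comment> \<open>independent increments over finitely many disjoint rectangles\<close>
     (\<forall>(I::nat set) S T. finite I \<longrightarrow> (\<forall>i\<in>I. is_rect (S i) (T i)) \<longrightarrow>
        (\<forall>i\<in>I. \<forall>j\<in>I. i \<noteq> j \<longrightarrow> rect_set (S i) (T i) \<inter> rect_set (S j) (T j) = {}) \<longrightarrow>
        prob_space.indep_vars M (\<lambda>_. borel) (\<lambda>i. incr X (S i) (T i)) I) \<and>
     \<comment> \<open>stationarity under translations\<close>
     (\<forall>s t p. is_rect s t \<longrightarrow> p \<in> quad \<longrightarrow>
        distr M borel (incr X s t) = distr M borel (incr X (s + p) (t + p))) \<and>
     \<comment> \<open>vanishing on the axes a.s.\<close>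
     (AE \<omega> in M. \<forall>t\<in>quad. (fst t = 0 \<or> snd t = 0) \<longrightarrow> X t \<omega> = 0) \<and>
     \<comment> \<open>continuity in probability\<close>
     (\<forall>t\<in>quad. \<forall>e>0. ((\<lambda>s. measure M {\<omega>\<in>space M. dist (X s \<omega>) (X t \<omega>) > e}) \<longlongrightarrow> 0)
        (at t within quad)) \<and>
     \<comment> \<open>a.s. right continuous paths with quadrantal limits\<close>
     (AE \<omega> in M. rcql (\<lambda>t. X t \<omega>))"

definition TPLP_exponent :: "'a measure \<Rightarrow> (real \<times> real \<Rightarrow> 'a \<Rightarrow> 'v::euclidean_space) \<Rightarrow> ('v \<Rightarrow> complex) \<Rightarrow> bool" where
  "TPLP_exponent M X \<psi> \<longleftrightarrow> (\<forall>s t z. is_rect s t \<longrightarrow>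
     integral\<^sup>L M (\<lambda>\<omega>. cis (inner z (incr X s t \<omega>))) = exp (complex_of_real (rect_area s t) * \<psi> z))"

definition nondeterministic :: "'a measure \<Rightarrow> (real \<times> real \<Rightarrow> 'a \<Rightarrow> 'v) \<Rightarrow> bool" where
  "nondeterministic M X \<longleftrightarrow> \<not> (\<exists>c. AE \<omega> in M. X (1,1) \<omega> = c)"

definition symmetric_proc :: "'a measure \<Rightarrow> (real \<times> real \<Rightarrow> 'a \<Rightarrow> 'v::euclidean_space) \<Rightarrow> bool" where
  "symmetric_proc M X \<longleftrightarrow>
     distr M (Pi\<^sub>M quad (\<lambda>_. borel)) (\<lambda>\<omega>. \<lambda>t\<in>quad. X t \<omega>) =
     distr M (Pi\<^sub>M quad (\<lambda>_. borel)) (\<lambda>\<omega>. \<lambda>t\<in>quad. - X t \<omega>)"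

definition decreasing_path :: "real set \<Rightarrow> (real \<Rightarrow> real) \<Rightarrow> (real \<Rightarrow> real) \<Rightarrow> bool" where
  "decreasing_path T x y \<longleftrightarrow> is_interval T \<and>
     continuous_on T x \<and> continuous_on T y \<and>
     mono_on T x \<and> antimono_on T y \<and>
     (\<forall>t\<in>interior T. 0 < x t \<and> 0 < y t) \<and>
     \<not> ((\<exists>k. \<forall>t\<in>T. x t = k) \<and> (\<exists>k. \<forall>t\<in>T. y t = k))"

definition stationary_increments_along ::
  "'a measure \<Rightarrow> (real \<times> real \<Rightarrow> 'a \<Rightarrow> 'v::euclidean_space) \<Rightarrow> real set \<Rightarrow> (real \<Rightarrow> real) \<Rightarrow> (real \<Rightarrow> real) \<Rightarrow> bool" where
  "stationary_increments_along M X T x y \<longleftrightarrow>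
     (\<forall>s\<in>T. \<forall>t\<in>T. \<forall>s'\<in>T. \<forall>t'\<in>T. s < t \<longrightarrow> s' < t' \<longrightarrow> t - s = t' - s' \<longrightarrow>
        distr M borel (\<lambda>\<omega>. X (x t, y t) \<omega> - X (x s, y s) \<omega>) =
        distr M borel (\<lambda>\<omega>. X (x t', y t') \<omega> - X (x s', y s') \<omega>))"

definition incr_charfun ::
  "'a measure \<Rightarrow> (real \<times> real \<Rightarrow> 'a \<Rightarrow> 'v::euclidean_space) \<Rightarrow> (real \<Rightarrow> real) \<Rightarrow> (real \<Rightarrow> real) \<Rightarrow> real \<Rightarrow> real \<Rightarrow> 'v \<Rightarrow> complex" where
  "incr_charfun M X x y s t z =
     integral\<^sup>L M (\<lambda>\<omega>. cis (inner z (X (x t, y t) \<omega> - X (x s, y s) \<omega>)))"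

definition cond_i :: "real set \<Rightarrow> (real \<Rightarrow> real) \<Rightarrow> (real \<Rightarrow> real) \<Rightarrow> real \<Rightarrow> real \<Rightarrow> real \<Rightarrow> bool" where
  "cond_i T x y a b c \<longleftrightarrow> 0 < a \<and> 0 < c \<and>
     ((\<forall>t\<in>T. x t = a \<and> y t = b - c * t) \<or> (\<forall>t\<in>T. x t = b + c * t \<and> y t = a))"

definition phi_i :: "real \<Rightarrow> real \<Rightarrow> real \<Rightarrow> real" where
  "phi_i a c u = a * c * u"

definition cond_ii :: "real set \<Rightarrow> (real \<Rightarrow> real) \<Rightarrow> (real \<Rightarrow> real) \<Rightarrow> real \<Rightarrow> real \<Rightarrow> real \<Rightarrow> real \<Rightarrow> real \<Rightarrow> bool" where
  "cond_ii T x y s0 a b c d \<longleftrightarrow> s0 \<in> interior T \<and> 0 < a \<and> 0 < b \<and> 0 < c \<and> 0 < d \<and> a * c = b * d \<and>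
     (\<forall>t\<in>T. x t = a + d * (t - s0) * (if t > s0 then 1 else 0) \<and>
             y t = b - c * (t - s0) * (if t \<le> s0 then 1 else 0))"

definition phi_ii :: "real \<Rightarrow> real \<Rightarrow> real \<Rightarrow> real" where
  "phi_ii a c u = a * c * u"

definition cond_iii :: "real set \<Rightarrow> (real \<Rightarrow> real) \<Rightarrow> (real \<Rightarrow> real) \<Rightarrow> real \<Rightarrow> real \<Rightarrow> real \<Rightarrow> real \<Rightarrow> bool" where
  "cond_iii T x y a b c d \<longleftrightarrow> 0 < b \<and> 0 < d \<and> (\<forall>t\<in>T. x t = a + b * t \<and> y t = c - d * t)"

definition phi_iii :: "real \<Rightarrow> real \<Rightarrow> real \<Rightarrow> real \<Rightarrow> real \<Rightarrow> real" where
  "phi_iii a b c d u = (a * d + b * c) * u - b * d * u ^ 2"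

definition cond_iv :: "real set \<Rightarrow> (real \<Rightarrow> real) \<Rightarrow> (real \<Rightarrow> real) \<Rightarrow> real \<Rightarrow> real \<Rightarrow> real \<Rightarrow> bool" where
  "cond_iv T x y a b c \<longleftrightarrow> 0 < a \<and> 0 < b \<and> 0 < c \<and>
     (\<forall>t\<in>T. x t = a * exp (c * t) \<and> y t = b * exp (- c * t))"

definition phi_iv :: "real \<Rightarrow> real \<Rightarrow> real \<Rightarrow> real \<Rightarrow> real" where
  "phi_iv a b c u = 2 * a * b * (1 - exp (- c * u))"

end

theory Submission
  imports Defs
begin

text \<open>
  Along a decreasing path, the increment over \<open>[s, t]\<close> is the difference of the increments of \<open>X\<close> over two
  disjoint rectangles of areas \<open>A = y\<^sub>t (x\<^sub>t - x\<^sub>s)\<close> and \<open>B = x\<^sub>s (y\<^sub>s - y\<^sub>t)\<close>, so its exponent is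
  \<open>A \<psi>(z) + B \<psi>(-z) = (A + B) Re \<psi>(z) + i (A - B) Im \<psi>(z)\<close>. Hence stationarity means that \<open>A + B\<close>
  depends only on \<open>t - s\<close>, and so does \<open>A - B = x\<^sub>t y\<^sub>t - x\<^sub>s y\<^sub>s\<close> unless \<open>\<psi>\<close> is real, that is, unless
  \<open>X\<close> is symmetric.

  If \<open>A + B\<close> depends only on \<open>t - s\<close>, then so do its mixed second differences, which are products of
  increments of \<open>x\<close> and \<open>y\<close>. If \<open>x\<close> or \<open>y\<close> is constant on some interval, this forces (i) or (ii).
  Otherwise shifting by \<open>h\<close> multiplies all increments of \<open>x\<close> by a common factor \<open>e\<^bsup>ch\<^esup>\<close> and those of
  \<open>y\<close> by \<open>e\<^bsup>-ch\<^esup>\<close>, which gives (iii) for \<open>c = 0\<close> and (iv) for \<open>c \<noteq> 0\<close>. If \<open>A - B\<close> also depends only on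
  \<open>t - s\<close>, then \<open>x y\<close> is affine, which rules out (ii) and (iii).
\<close>

section \<open>Functional equations on an interval\<close>

text \<open>The path is only monotone and continuous, so no differential equation for
  \<open>x\<close> and \<open>y\<close> is available. Differences take its place: a continuous
  solution of a second-difference equation is pinned down by a maximum principle, which needs only
  the sign of the factor. Positivity of \<open>x\<close> and \<open>y\<close> is given only on the
  interior of \<open>T\<close>; all cancellations happen there, and the resulting formulas reach the
  end points of \<open>T\<close> by continuity. The modulus of a characteristic function sees
  \<open>A + B\<close> only through \<open>Re \<psi>\<close>, so nondeterminism must supply a
  \<open>z\<close> with \<open>Re (\<psi> z) \<noteq> 0\<close>. The phase sees \<open>A - B\<close>
  only modulo \<open>2 * pi\<close>. Symmetry concerns the law of the whole family, so a real
  \<open>\<psi>\<close> has to be lifted through all finite-dimensional laws; for this, uniqueness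
  of characteristic functions is bootstrapped from the real line to finite families of vectors by
  turning exponentials into indicators one at a time.\<close>

lemma compact_level_set:
  fixes f :: "real \<Rightarrow> real"
  assumes "continuous_on {a..b} f"
  shows "compact {r \<in> {a..b}. f r = c}"
  using continuous_closed_preimage_constant[OF assms closed_atLeastAtMost, of c]
  by (auto simp: compact_eq_bounded_closed intro: bounded_subset[of "{a..b}"])

text \<open>Maximum principle. The difference of \<open>g\<close> and a chord
  \<open>A + B * E\<close> solves the same equation; a positive maximum inside would, at its
  leftmost point, have a positive backward difference and a nonpositive forward one, against the
  positive factor \<open>w h\<close>. So \<open>g\<close> lies on its chord between any two points,
  and injectivity of \<open>E\<close> makes chords exist and fit together.\<close>

lemma affine_in_second_difference_solution:
  fixes g E w :: "real \<Rightarrow> real"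
  assumes I: "is_interval I" and g: "continuous_on I g" and E: "continuous_on I E"
    and inj: "inj_on E I" and e: "0 < e"
    and w: "\<And>h. 0 < h \<Longrightarrow> h < e \<Longrightarrow> 0 < w h"
    and dg: "\<And>t h. 0 < h \<Longrightarrow> h < e \<Longrightarrow> t - h \<in> I \<Longrightarrow> t + h \<in> I \<Longrightarrow> g (t + h) - g t = w h * (g t - g (t - h))"
    and dE: "\<And>t h. 0 < h \<Longrightarrow> h < e \<Longrightarrow> t - h \<in> I \<Longrightarrow> t + h \<in> I \<Longrightarrow> E (t + h) - E t = w h * (E t - E (t - h))"
  shows "\<exists>A B. \<forall>t\<in>I. g t = A + B * E t"
proof -
  have nonpos: "f t \<le> 0"
    if ab: "a \<in> I" "b \<in> I" "a \<le> t" "t \<le> b" and f0: "f a = 0" "f b = 0" and fc: "continuous_on I f"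
      and df: "\<And>t h. 0 < h \<Longrightarrow> h < e \<Longrightarrow> t - h \<in> I \<Longrightarrow> t + h \<in> I \<Longrightarrow> f (t + h) - f t = w h * (f t - f (t - h))"
    for f :: "real \<Rightarrow> real" and a b t
  proof (rule ccontr)
    assume "\<not> f t \<le> 0"
    have sub: "{a..b} \<subseteq> I" using mem_is_interval_1_I[OF I ab(1,2)] by auto
    have cab: "continuous_on {a..b} f" using continuous_on_subset[OF fc sub] .
    obtain m where m: "m \<in> {a..b}" "\<And>s. s \<in> {a..b} \<Longrightarrow> f s \<le> f m"
      using continuous_attains_sup[of "{a..b}" f] cab ab by auto
    define K where "K = {s \<in> {a..b}. f s = f m}"
    have "compact K" unfolding K_def by (rule compact_level_set[OF cab])
    moreover have "K \<noteq> {}" using m K_def by auto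
    ultimately obtain k where k: "k \<in> K" "\<And>s. s \<in> K \<Longrightarrow> k \<le> s"
      using compact_attains_inf by meson
    have fm: "f m > 0" using m(2)[of t] \<open>\<not> f t \<le> 0\<close> ab by simp
    have fk: "f k = f m" "a \<le> k" "k \<le> b" using k K_def by auto
    have "k \<noteq> a" "k \<noteq> b" using fk fm f0 by auto
    then have kab: "a < k" "k < b" using fk by auto
    define h where "h = min (e/2) (min (k - a) (b - k))"
    have h: "0 < h" "h < e" "h \<le> k - a" "h \<le> b - k"
      using e kab by (auto simp: h_def)
    have in1: "k - h \<in> {a..b}" "k + h \<in> {a..b}" using h kab by auto
    have "f (k - h) < f k"
    proof (rule ccontr)
      assume "\<not> f (k - h) < f k"
      then have "k - h \<in> K" using m(2)[of "k - h"] in1 fk K_def by auto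
      then show False using k(2)[of "k - h"] h by simp
    qed
    moreover have "f (k + h) \<le> f k" using m(2)[of "k + h"] in1 fk by simp
    moreover have "f (k + h) - f k = w h * (f k - f (k - h))"
      using df h in1 sub by blast
    moreover have "0 < w h * (f k - f (k - h))"
      using w h \<open>f (k - h) < f k\<close> by (intro mult_pos_pos) auto
    ultimately show False by linarith
  qed
  have chord: "g t = A + B * E t"
    if ab: "a \<in> I" "b \<in> I" "a \<le> t" "t \<le> b" and gA: "g a = A + B * E a" "g b = A + B * E b" for a b t A B
  proof -
    define f where "f = (\<lambda>t. g t - A - B * E t)"
    have fc: "continuous_on I f" unfolding f_def by (intro continuous_intros g E)
    have df: "f (t + h) - f t = w h * (f t - f (t - h))"
      if "0 < h" "h < e" "t - h \<in> I" "t + h \<in> I" for t h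
    proof -
      have "f (t + h) - f t = (g (t + h) - g t) - B * (E (t + h) - E t)"
        by (simp add: f_def algebra_simps)
      also have "\<dots> = w h * (f t - f (t - h))"
        unfolding dg[OF that] dE[OF that] by (simp add: f_def algebra_simps)
      finally show ?thesis .
    qed
    have "f t \<le> 0"
      by (rule nonpos[OF ab _ _ fc df]) (use gA in \<open>auto simp: f_def\<close>)
    moreover have "- f t \<le> 0"
    proof (rule nonpos[OF ab, where f = "\<lambda>t. - f t"])
      show "- f (t + h) - - f t = w h * (- f t - - f (t - h))"
        if "0 < h" "h < e" "t - h \<in> I" "t + h \<in> I" for t h
        using df[OF that] by (simp add: algebra_simps)
    qed (use gA in \<open>auto simp: f_def intro!: continuous_intros g E\<close>)
    ultimately have "f t = 0" by simp
    then show ?thesis by (simp add: f_def)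
  qed
  show ?thesis
  proof (cases "\<exists>p\<in>I. \<exists>q\<in>I. p < q")
    case False
    show ?thesis
    proof (cases "I = {}")
      case True
      then show ?thesis by simp
    next
      case ne: False
      then obtain p where "p \<in> I" by auto
      then have "t = p" if "t \<in> I" for t using False that by (cases t p rule: linorder_cases) auto
      then show ?thesis by (intro exI[of _ "g p"] exI[of _ 0]) auto
    qed
  next
    case True
    then obtain p q where pq: "p \<in> I" "q \<in> I" "p < q" by auto
    have interp: "\<exists>A B. g a = A + B * E a \<and> g b = A + B * E b" if "a \<in> I" "b \<in> I" "a < b" for a b
    proof -
      have "E a \<noteq> E b" using inj that by (auto dest: inj_onD)
      define B where "B = (g b - g a) / (E b - E a)"
      have "B * (E b - E a) = g b - g a" using \<open>E a \<noteq> E b\<close> by (simp add: B_def)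
      then have "g a = (g a - B * E a) + B * E a" "g b = (g a - B * E a) + B * E b"
        by (simp_all add: algebra_simps)
      then show ?thesis by blast
    qed
    obtain A B where AB: "g p = A + B * E p" "g q = A + B * E q" using interp pq by blast
    have "g t = A + B * E t" if t: "t \<in> I" for t
    proof -
      \<comment> \<open>Enlarge the interval so that it contains \<open>p\<close>, \<open>q\<close>
        and \<open>t\<close>; its chord is the one through \<open>p\<close> and \<open>q\<close>,
        because \<open>E p \<noteq> E q\<close> fixes both coefficients.\<close>
      define a where "a = min p t"
      define b where "b = max q t"
      have ab: "a \<in> I" "b \<in> I" "a < b" "a \<le> p" "p \<le> b" "a \<le> q" "q \<le> b" "a \<le> t" "t \<le> b"
        using pq t by (auto simp: a_def b_def min_def max_def)
      then obtain A' B' where A': "g a = A' + B' * E a" "g b = A' + B' * E b" using interp by blast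
      have c: "g p = A' + B' * E p" "g q = A' + B' * E q" "g t = A' + B' * E t"
        using chord[of a b] ab A' by blast+
      have "E p \<noteq> E q" using inj pq by (auto dest: inj_onD)
      moreover have "(B - B') * (E p - E q) = 0" using c AB by (simp add: algebra_simps)
      ultimately have "B = B'" by simp
      then show ?thesis using c AB by auto
    qed
    then show ?thesis by blast
  qed
qed

lemma affine_if_shift_invariant_increments:
  fixes g :: "real \<Rightarrow> real"
  assumes I: "is_interval I" and g: "continuous_on I g" and e: "0 < e"
    and dg: "\<And>t h. 0 < h \<Longrightarrow> h < e \<Longrightarrow> t - h \<in> I \<Longrightarrow> t + h \<in> I \<Longrightarrow> g (t + h) - g t = g t - g (t - h)"
  shows "\<exists>A B. \<forall>t\<in>I. g t = A + B * t"
proof (rule affine_in_second_difference_solution[OF I g, of "\<lambda>t. t" e "\<lambda>_. 1"])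
  show "g (t + h) - g t = 1 * (g t - g (t - h))" if "0 < h" "h < e" "t - h \<in> I" "t + h \<in> I" for t h
    using dg[OF that] by simp
qed (use e in auto)

text \<open>The preimage of a closed set is \<open>T\<close> cut by a closed \<open>K\<close>, and a
  closed \<open>K\<close> that contains the interior contains its closure. This carries facts known
  on the interior to the end points of \<open>T\<close>.\<close>

lemma closed_image_from_interior:
  fixes f :: "real \<Rightarrow> real"
  assumes T: "T \<subseteq> closure (interior T)" and f: "continuous_on T f" and C: "closed C"
    and fC: "\<And>t. t \<in> interior T \<Longrightarrow> f t \<in> C" and t: "t \<in> T"
  shows "f t \<in> C"
proof -
  obtain K where K: "closed K" "T \<inter> f -` C = T \<inter> K"
    using continuous_closedin_preimage[OF f C] by (auto simp: closedin_closed)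
  have "interior T \<subseteq> K" using fC K(2) interior_subset[of T] by blast
  then have "T \<subseteq> K" using T closure_minimal[OF _ K(1)] by blast
  then show ?thesis using K t by auto
qed

lemma eq_from_interior:
  fixes f g :: "real \<Rightarrow> real"
  assumes T: "T \<subseteq> closure (interior T)" and f: "continuous_on T f" and g: "continuous_on T g"
    and eq: "\<And>t. t \<in> interior T \<Longrightarrow> f t = g t" and t: "t \<in> T"
  shows "f t = g t"
  using closed_image_from_interior[OF T continuous_on_diff[OF f g], of "{0}" t] eq t by simp

section \<open>Paths with shift-invariant rate\<close>

text \<open>The sum \<open>A + B\<close> of the two rectangle areas, the coefficient of
  \<open>Re \<psi>\<close> in the exponent of an increment.\<close>

definition path_rate :: "(real \<Rightarrow> real) \<Rightarrow> (real \<Rightarrow> real) \<Rightarrow> real \<Rightarrow> real \<Rightarrow> real" where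
  "path_rate x y s t = y t * (x t - x s) + x s * (y s - y t)"

text \<open>A coordinate that is not constant takes different values at two points of
  \<open>T\<close>, and an interval with two points lies in the closure of its nonempty
  interior.\<close>

lemma decreasing_path_subset_closure_interior:
  assumes "decreasing_path T x y"
  shows "T \<subseteq> closure (interior T)" and "interior T \<noteq> {}"
proof -
  have I: "is_interval T" and nc: "\<not> ((\<exists>k. \<forall>t\<in>T. x t = k) \<and> (\<exists>k. \<forall>t\<in>T. y t = k))"
    using assms by (auto simp: decreasing_path_def)
  obtain p q where pq: "p \<in> T" "q \<in> T" "p < q"
    using nc by (metis linorder_neqE_linordered_idom)
  have "{p..q} \<subseteq> T" using mem_is_interval_1_I[OF I pq(1,2)] by auto
  then have "interior {p..q} \<subseteq> interior T" by (rule interior_mono)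
  moreover have "(p + q) / 2 \<in> interior {p..q}" using pq by simp
  ultimately show ne: "interior T \<noteq> {}" by blast
  show "T \<subseteq> closure (interior T)"
    using convex_closure_interior[OF _ ne] I closure_subset[of T] by (simp add: is_interval_convex)
qed

lemma decreasing_path_nonneg:
  assumes "decreasing_path T x y" "t \<in> T"
  shows "0 \<le> x t" "0 \<le> y t"
proof -
  note * = closed_image_from_interior[OF decreasing_path_subset_closure_interior(1)[OF assms(1)] _ closed_atLeast _ assms(2), of _ 0]
  have "x t \<in> {0..}"
    by (rule *) (use assms(1) in \<open>auto simp: decreasing_path_def intro: less_imp_le\<close>)
  moreover have "y t \<in> {0..}"
    by (rule *) (use assms(1) in \<open>auto simp: decreasing_path_def intro: less_imp_le\<close>)
  ultimately show "0 \<le> x t" "0 \<le> y t" by simp_all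
qed

locale stationary_path =
  fixes T :: "real set" and x y :: "real \<Rightarrow> real"
  assumes path: "decreasing_path T x y"
    and rate: "\<And>s t s' t'. \<lbrakk>s \<in> T; t \<in> T; s' \<in> T; t' \<in> T; s < t; s' < t'; t - s = t' - s'\<rbrakk>
      \<Longrightarrow> path_rate x y s t = path_rate x y s' t'"
begin

text \<open>The interior offers positivity of both coordinates and room on both sides of every
  point.\<close>

definition J where "J = interior T"

lemma J_T: "t \<in> J \<Longrightarrow> t \<in> T"
  using interior_subset by (auto simp: J_def)

lemma J_interval: "is_interval J"
  using path by (simp add: J_def decreasing_path_def is_interval_convex_1 convex_interior)

lemmas J_between = mem_is_interval_1_I[OF J_interval]

lemma J_room:
  assumes "t \<in> J"
  shows "\<exists>e>0. \<forall>h. \<bar>h\<bar> \<le> e \<longrightarrow> t + h \<in> J"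
proof -
  obtain e where e: "0 < e" "cball t e \<subseteq> J"
    using assms open_contains_cball[of J] by (auto simp: J_def)
  then show ?thesis by (intro exI[of _ e]) (auto simp: subset_eq dist_real_def)
qed

lemma mono: "s \<in> J \<Longrightarrow> t \<in> J \<Longrightarrow> s \<le> t \<Longrightarrow> x s \<le> x t"
  using path J_T[of s] J_T[of t] unfolding decreasing_path_def monotone_on_def by blast

lemma antimono: "s \<in> J \<Longrightarrow> t \<in> J \<Longrightarrow> s \<le> t \<Longrightarrow> y t \<le> y s"
  using path J_T[of s] J_T[of t] unfolding decreasing_path_def monotone_on_def by blast

lemma pos: "t \<in> J \<Longrightarrow> 0 < x t" "t \<in> J \<Longrightarrow> 0 < y t"
  using path by (auto simp: decreasing_path_def J_def)

lemma cont: "continuous_on T x" "continuous_on T y"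
  using path by (auto simp: decreasing_path_def)

lemma contJ: "continuous_on J x" "continuous_on J y"
  using cont[THEN continuous_on_subset, of J] interior_subset[of T] by (auto simp: J_def)

lemma rateJ: "\<lbrakk>s \<in> J; t \<in> J; s' \<in> J; t' \<in> J; s \<le> t; t - s = t' - s'\<rbrakk>
      \<Longrightarrow> path_rate x y s t = path_rate x y s' t'"
  using rate[of s t s' t'] J_T[of s] J_T[of t] J_T[of s'] J_T[of t']
  by (cases "s = t") (auto simp: path_rate_def)

lemma not_both_constant:
  "\<not> ((\<forall>s\<in>J. \<forall>t\<in>J. x s = x t) \<and> (\<forall>s\<in>J. \<forall>t\<in>J. y s = y t))"
proof
  assume c: "(\<forall>s\<in>J. \<forall>t\<in>J. x s = x t) \<and> (\<forall>s\<in>J. \<forall>t\<in>J. y s = y t)"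
  obtain p where p: "p \<in> J" using decreasing_path_subset_closure_interior(2)[OF path] by (auto simp: J_def)
  note eq = eq_from_interior[OF decreasing_path_subset_closure_interior(1)[OF path]]
  have "x t = x p" if "t \<in> T" for t
  proof (rule eq[OF cont(1) continuous_on_const _ that])
    show "x t = x p" if "t \<in> interior T" for t using c that p unfolding J_def by blast
  qed
  moreover have "y t = y p" if "t \<in> T" for t
  proof (rule eq[OF cont(2) continuous_on_const _ that])
    show "y t = y p" if "t \<in> interior T" for t using c that p unfolding J_def by blast
  qed
  ultimately show False using path by (auto simp: decreasing_path_def)
qed

text \<open>If neither coordinate moved between \<open>s\<close> and \<open>t\<close>, the rate
  would vanish for every span up to \<open>t - s\<close>, everywhere in \<open>J\<close> by shift
  invariance. As both its terms are nonnegative and \<open>x\<close>, \<open>y\<close> are positive,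
  the path would be locally constant, hence constant on the connected \<open>J\<close>.\<close>

lemma rate_pos:
  assumes st: "s \<in> J" "t \<in> J" "s < t"
  shows "x s < x t \<or> y t < y s"
proof (rule ccontr)
  assume "\<not> (x s < x t \<or> y t < y s)"
  then have xy: "x s = x t" "y s = y t" using mono[of s t] antimono[of s t] st by auto
  have const: "x p = x q \<and> y p = y q" if pq: "p \<in> J" "q \<in> J" "p \<le> q" "q - p \<le> t - s" for p q
  proof -
    define q' where "q' = s + (q - p)"
    have q': "q' \<in> J" "s \<le> q'" "q' \<le> t" using J_between[OF st(1,2)] pq by (auto simp: q'_def)
    have "x q' = x s" "y q' = y s"
      using mono[of s q'] mono[of q' t] antimono[of s q'] antimono[of q' t] st q' xy by auto
    then have "path_rate x y s q' = 0" by (simp add: path_rate_def)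
    then have 0: "path_rate x y p q = 0" using rateJ[OF pq(1,2) st(1) q'(1) pq(3)] by (simp add: q'_def)
    have "0 \<le> y q * (x q - x p)" "0 \<le> x p * (y p - y q)"
      using pos[of p] pos[of q] mono[of p q] antimono[of p q] pq by auto
    then have "y q * (x q - x p) = 0" "x p * (y p - y q) = 0" using 0 unfolding path_rate_def by linarith+
    then show ?thesis using pos[of p] pos[of q] pq by auto
  qed
  have near: "\<forall>\<^sub>F q in at p within J. x p = x q \<and> y p = y q" if "p \<in> J" for p
    unfolding eventually_at
  proof (intro exI[of _ "t - s"] conjI ballI impI)
    fix q assume "q \<in> J" "q \<noteq> p \<and> dist q p < t - s"
    then have "p \<le> q \<and> q - p \<le> t - s \<or> q \<le> p \<and> p - q \<le> t - s" by (auto simp: dist_real_def)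
    then show "x p = x q" "y p = y q"
      using const[OF that \<open>q \<in> J\<close>] const[OF \<open>q \<in> J\<close> that] by metis+
  qed (use st in auto)
  have con: "connected J" using J_interval by (simp add: is_interval_connected_1)
  have "\<forall>p\<in>J. \<forall>\<^sub>F q in at p within J. x p = x q" "\<forall>p\<in>J. \<forall>\<^sub>F q in at p within J. y p = y q"
    using near unfolding eventually_conj_iff by blast+
  then have "(\<forall>s\<in>J. \<forall>t\<in>J. x s = x t) \<and> (\<forall>s\<in>J. \<forall>t\<in>J. y s = y t)"
    using connected_local_const[OF con] by blast
  then show False using not_both_constant by simp
qed

text \<open>The defect of additivity is a pure product: it vanishes as soon as \<open>x\<close>
  agrees at \<open>s\<close> and \<open>t\<close>, or \<open>y\<close> at \<open>t\<close> and
  \<open>r\<close>.\<close>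

lemma rate_add:
  "path_rate x y s t + path_rate x y t r - path_rate x y s r = 2 * ((x t - x s) * (y t - y r))"
  by (simp add: path_rate_def algebra_simps)

text \<open>The second difference of the rate in its two end points kills every term that depends on
  one of them alone and leaves twice a product of increments. The order
  \<open>s \<le> s' \<le> t \<le> t'\<close> makes all four spans nonnegative, as
  \<open>rateJ\<close> requires.\<close>

lemma mixed_difference_shift:
  assumes "s \<in> J" "s' \<in> J" "t \<in> J" "t' \<in> J" "s + h \<in> J" "s' + h \<in> J" "t + h \<in> J" "t' + h \<in> J"
    and "s \<le> s'" "s' \<le> t" "t \<le> t'"
  shows "(x (s' + h) - x (s + h)) * (y (t + h) - y (t' + h)) = (x s' - x s) * (y t - y t')"
proof -
  have mixed: "2 * ((x s' - x s) * (y t - y t')) =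
      path_rate x y s t + path_rate x y s' t' - path_rate x y s t' - path_rate x y s' t" for s s' t t'
    by (simp add: path_rate_def algebra_simps)
  have "path_rate x y p q = path_rate x y (p + h) (q + h)" if "p \<in> {s, s'}" "q \<in> {t, t'}" for p q
    by (rule rateJ) (use assms that in auto)
  then show ?thesis using mixed[of s' s t t'] mixed[of "s' + h" "s + h" "t + h" "t' + h"] by simp
qed

text \<open>If \<open>x\<close> or \<open>y\<close> is constant on some subinterval, the rate is additive for small time spans. At a
  point where \<open>x\<close> increases immediately before and \<open>y\<close> decreases immediately after, it is not.\<close>

lemma no_increase_before_decrease:
  assumes pq: "p \<in> J" "q \<in> J" "p < q" "x p = x q \<or> y p = y q"
    and st: "s \<in> J" "t' \<in> J" "s < s'" "s' \<le> t" "t < t'" "x s < x s'"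
  shows "y t = y t'"
proof (rule ccontr)
  assume "y t \<noteq> y t'"
  have inJ: "r \<in> J" if "s \<le> r" "r \<le> t'" for r using J_between[OF st(1,2) that] .
  have yt: "y t' < y t" using antimono[of t t'] \<open>y t \<noteq> y t'\<close> inJ st by fastforce
  \<comment> \<open>\<open>s1\<close> will be the first time at which \<open>x\<close> reaches
    \<open>x s'\<close>, so that \<open>x\<close> is strictly smaller before it.\<close>
  define S where "S = {r \<in> {s..s'}. x r = x s'}"
  have "{s..s'} \<subseteq> J" using inJ st by auto
  then have "compact S" unfolding S_def
    by (intro compact_level_set continuous_on_subset[OF contJ(1)])
  moreover have "s' \<in> S" using st by (simp add: S_def)
  ultimately obtain s1 where s1: "s1 \<in> S" "\<And>r. r \<in> S \<Longrightarrow> s1 \<le> r"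
    using compact_attains_inf[of S] by auto
  have s1': "s < s1" "s1 \<le> s'" "x s1 = x s'" using s1(1) st by (auto simp: S_def less_le)
  have before: "x r < x s1" if "s \<le> r" "r < s1" for r
  proof -
    have "r \<notin> S" using s1(2) that by fastforce
    then show ?thesis using mono[of r s1] inJ that s1' st by (auto simp: S_def less_le)
  qed
  \<comment> \<open>\<open>m\<close> will be the last time at which \<open>y\<close> still has its
    value at \<open>s1\<close>, so that \<open>y\<close> is strictly smaller afterwards. Between
    \<open>s1\<close> and \<open>m\<close> the function \<open>y\<close> is constant, and
    \<open>rate_pos\<close> makes \<open>x\<close> strictly increase up to \<open>m\<close>.\<close>
  define U where "U = {r \<in> {s1..t'}. y r = y s1}"
  have "{s1..t'} \<subseteq> J" using inJ s1' st by auto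
  then have "compact U" unfolding U_def
    by (intro compact_level_set continuous_on_subset[OF contJ(2)])
  moreover have "s1 \<in> U" using st s1' by (simp add: U_def)
  ultimately obtain m where m: "m \<in> U" "\<And>r. r \<in> U \<Longrightarrow> r \<le> m"
    using compact_attains_sup[of U] by auto
  have "y t \<le> y s1" using antimono[of s1 t] inJ s1' st by auto
  then have m': "s1 \<le> m" "m < t'" "y m = y s1" using m(1) yt by (auto simp: U_def less_le)
  have after: "y r < y m" if "m < r" "r \<le> t'" for r
  proof -
    have "r \<notin> U" using m(2) that by fastforce
    then show ?thesis using antimono[of s1 r] inJ that m' s1' st by (auto simp: U_def less_le)
  qed
  have before_m: "x r < x m" if r: "s \<le> r" "r < m" for r
  proof (cases "r < s1")
    case True
    then show ?thesis using before[of r] mono[of s1 m] inJ r m' s1' by fastforce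
  next
    case False
    then have "y r = y m" using antimono[of s1 r] antimono[of r m] inJ r m' s1' by fastforce
    then show ?thesis using rate_pos[of r m] inJ r m' by auto
  qed
  \<comment> \<open>Two steps of length \<open>h\<close> fit between \<open>p\<close> and
    \<open>q\<close>, where one coordinate is constant and the rate is additive, and one step fits
    on either side of \<open>m\<close>, where it is not.\<close>
  define h where "h = min ((q - p) / 2) (min (m - s) (t' - m))"
  have h: "0 < h" "2 * h \<le> q - p" "s \<le> m - h" "m + h \<le> t'"
  proof -
    have "h \<le> (q - p) / 2" "h \<le> m - s" "h \<le> t' - m" unfolding h_def by linarith+
    then show "2 * h \<le> q - p" "s \<le> m - h" "m + h \<le> t'" by auto
    show "0 < h" using pq m' s1' by (auto simp: h_def)
  qed
  have ph: "p + h \<in> J" "p + 2 * h \<in> J" using J_between[OF pq(1,2)] h by auto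
  have "x (p + h) = x p \<or> y (p + h) = y (p + 2 * h)"
    using mono[of p "p + h"] mono[of "p + h" q] antimono[of p "p + h"] antimono[of "p + h" "p + 2 * h"]
      antimono[of "p + 2 * h" q] pq h ph by auto
  then have "path_rate x y p (p + h) + path_rate x y (p + h) (p + 2 * h) = path_rate x y p (p + 2 * h)"
    using rate_add[of p "p + h" "p + 2 * h"] by auto
  moreover have "path_rate x y p (p + h) = path_rate x y (m - h) m"
    "path_rate x y (p + h) (p + 2 * h) = path_rate x y m (m + h)"
    "path_rate x y p (p + 2 * h) = path_rate x y (m - h) (m + h)"
    using pq ph h inJ m' s1' by (auto intro!: rateJ)
  ultimately have "(x m - x (m - h)) * (y m - y (m + h)) = 0"
    using rate_add[of "m - h" m "m + h"] by simp
  then show False using before_m[of "m - h"] after[of "m + h"] h by auto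
qed

lemma on_T_from_J:
  assumes "continuous_on T f" "continuous_on T g" "\<And>t. t \<in> J \<Longrightarrow> f t = g t" "t \<in> T"
  shows "f t = (g t :: real)"
  using eq_from_interior[OF decreasing_path_subset_closure_interior(1)[OF path]] assms by (simp add: J_def)

text \<open>With \<open>x\<close> constant at \<open>a\<close>, the rate is \<open>a\<close> times
  the drop of \<open>y\<close>, so that drop depends only on the length of the step. The slope is
  nonzero by \<open>rate_pos\<close>.\<close>

lemma affine_where_x_constant:
  assumes I: "is_interval I" "I \<subseteq> J" and c: "\<And>t. t \<in> I \<Longrightarrow> x t = a" and pq: "p \<in> I" "q \<in> I" "p < q"
  shows "\<exists>b. \<exists>c>0. \<forall>t\<in>I. y t = b - c * t"
proof -
  have a: "a > 0" using c[OF pq(1)] pos(1)[of p] pq I by auto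
  have "y (t + h) - y t = y t - y (t - h)" if h: "0 < h" "t - h \<in> I" "t + h \<in> I" for t h
  proof -
    have t: "t \<in> I" using mem_is_interval_1_I[OF I(1) h(2,3)] h by auto
    have "path_rate x y t (t + h) = path_rate x y (t - h) t"
      by (rule rateJ) (use h t I in auto)
    then show ?thesis using c[OF t] c[OF h(2)] c[OF h(3)] a by (simp add: path_rate_def)
  qed
  then have "\<exists>A B. \<forall>t\<in>I. y t = A + B * t"
    by (intro affine_if_shift_invariant_increments[OF I(1) continuous_on_subset[OF contJ(2) I(2)], of 1]) auto
  then obtain A B where AB: "\<And>t. t \<in> I \<Longrightarrow> y t = A + B * t" by blast
  have "y q < y p" using rate_pos[of p q] c[OF pq(1)] c[OF pq(2)] pq I by auto
  then have "B * (q - p) < 0" using AB[OF pq(1)] AB[OF pq(2)] by (simp add: algebra_simps)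
  then have "B < 0" using pq by (auto simp: mult_less_0_iff)
  then show ?thesis using AB by (intro exI[of _ A] exI[of _ "- B"]) auto
qed

lemma affine_where_y_constant:
  assumes I: "is_interval I" "I \<subseteq> J" and c: "\<And>t. t \<in> I \<Longrightarrow> y t = a" and pq: "p \<in> I" "q \<in> I" "p < q"
  shows "\<exists>b. \<exists>c>0. \<forall>t\<in>I. x t = b + c * t"
proof -
  have a: "a > 0" using c[OF pq(1)] pos(2)[of p] pq I by auto
  have "x (t + h) - x t = x t - x (t - h)" if h: "0 < h" "t - h \<in> I" "t + h \<in> I" for t h
  proof -
    have t: "t \<in> I" using mem_is_interval_1_I[OF I(1) h(2,3)] h by auto
    have "path_rate x y t (t + h) = path_rate x y (t - h) t"
      by (rule rateJ) (use h t I in auto)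
    then show ?thesis using c[OF t] c[OF h(2)] c[OF h(3)] a by (simp add: path_rate_def)
  qed
  then have "\<exists>A B. \<forall>t\<in>I. x t = A + B * t"
    by (intro affine_if_shift_invariant_increments[OF I(1) continuous_on_subset[OF contJ(1) I(2)], of 1]) auto
  then obtain A B where AB: "\<And>t. t \<in> I \<Longrightarrow> x t = A + B * t" by blast
  have "x p < x q" using rate_pos[of p q] c[OF pq(1)] c[OF pq(2)] pq I by auto
  then have "B * (q - p) > 0" using AB[OF pq(1)] AB[OF pq(2)] by (simp add: algebra_simps)
  then have "B > 0" using pq by (auto simp: zero_less_mult_iff)
  then show ?thesis using AB by (intro exI[of _ A] exI[of _ B]) auto
qed

lemma J_two_points: obtains p q where "p \<in> J" "q \<in> J" "p < q"
proof -
  obtain p where p: "p \<in> J" using decreasing_path_subset_closure_interior(2)[OF path] by (auto simp: J_def)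
  then obtain e where "0 < e" "\<And>h. \<bar>h\<bar> \<le> e \<Longrightarrow> p + h \<in> J" using J_room by blast
  then show ?thesis using that[of p "p + e"] p by auto
qed

text \<open>Once \<open>x\<close> has increased, \<open>y\<close> never decreases again. If neither
  coordinate is constant, \<open>y\<close> therefore moves first and \<open>x\<close> afterwards,
  with a single corner between them.\<close>

lemma cond_i_or_ii:
  assumes no: "\<And>s s' t t'. \<lbrakk>s \<in> J; t' \<in> J; s < s'; s' \<le> t; t < t'; x s < x s'\<rbrakk> \<Longrightarrow> y t = y t'"
  shows "(\<exists>a b c. cond_i T x y a b c) \<or> (\<exists>s0 a b c d. cond_ii T x y s0 a b c d)"
proof -
  obtain p0 q0 where pq0: "p0 \<in> J" "q0 \<in> J" "p0 < q0" using J_two_points .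
  consider (x) "\<And>s t. s \<in> J \<Longrightarrow> t \<in> J \<Longrightarrow> x s = x t" | (y) "\<And>s t. s \<in> J \<Longrightarrow> t \<in> J \<Longrightarrow> y s = y t"
    | (neither) p q r w where "p \<in> J" "q \<in> J" "x p < x q" "r \<in> J" "w \<in> J" "y w < y r"
    by (metis linorder_neqE_linordered_idom)
  then show ?thesis
  proof cases
    case x
    have xa: "x t = x p0" if "t \<in> J" for t by (rule x[OF that pq0(1)])
    obtain b c where bc: "0 < c" "\<And>t. t \<in> J \<Longrightarrow> y t = b - c * t"
      using affine_where_x_constant[OF J_interval order_refl xa pq0] by blast
    have "x t = x p0" if "t \<in> T" for t
      by (rule on_T_from_J[OF cont(1) _ _ that]) (auto intro: xa)
    moreover have "y t = b - c * t" if "t \<in> T" for t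
      by (rule on_T_from_J[OF cont(2) _ _ that]) (use bc in \<open>auto intro!: continuous_intros\<close>)
    ultimately have "cond_i T x y (x p0) b c" using pos(1)[OF pq0(1)] bc(1) by (simp add: cond_i_def)
    then show ?thesis by blast
  next
    case y
    have ya: "y t = y p0" if "t \<in> J" for t by (rule y[OF that pq0(1)])
    obtain b c where bc: "0 < c" "\<And>t. t \<in> J \<Longrightarrow> x t = b + c * t"
      using affine_where_y_constant[OF J_interval order_refl ya pq0] by blast
    have "y t = y p0" if "t \<in> T" for t
      by (rule on_T_from_J[OF cont(2) _ _ that]) (auto intro: ya)
    moreover have "x t = b + c * t" if "t \<in> T" for t
      by (rule on_T_from_J[OF cont(1) _ _ that]) (use bc in \<open>auto intro!: continuous_intros\<close>)
    ultimately have "cond_i T x y (y p0) b c" using pos(2)[OF pq0(1)] bc(1) by (simp add: cond_i_def)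
    then show ?thesis by blast
  next
    case neither
    have rw: "r < w"
      using antimono[OF \<open>w \<in> J\<close> \<open>r \<in> J\<close>] \<open>y w < y r\<close> by (cases "r < w") auto
    have xr: "x t = x r" if t: "t \<in> J" "t \<le> r" for t
    proof (rule ccontr)
      assume "x t \<noteq> x r"
      then have "x t < x r" "t < r" using mono[OF t(1) \<open>r \<in> J\<close> t(2)] t by (auto simp: less_le)
      then show False using no[of t w r r] t rw neither by auto
    qed
    have xrq: "x r < x q"
    proof (cases "p \<le> r")
      case True
      then show ?thesis using xr[OF \<open>p \<in> J\<close>] neither by simp
    next
      case False
      then show ?thesis using mono[OF \<open>r \<in> J\<close> \<open>p \<in> J\<close>] neither by simp
    qed
    then have rq: "r < q" using xr[OF \<open>q \<in> J\<close>] by (cases "q \<le> r") auto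
    have rqJ: "{r..q} \<subseteq> J" using J_between[OF \<open>r \<in> J\<close> \<open>q \<in> J\<close>] by auto
    \<comment> \<open>The corner \<open>s0\<close> is the last time at which \<open>x\<close> still
      has the value it had up to \<open>r\<close>.\<close>
    define S where "S = {t \<in> {r..q}. x t = x r}"
    have "compact S" unfolding S_def by (intro compact_level_set continuous_on_subset[OF contJ(1) rqJ])
    moreover have "r \<in> S" using rq by (simp add: S_def)
    ultimately obtain s0 where s0: "s0 \<in> S" "\<And>t. t \<in> S \<Longrightarrow> t \<le> s0"
      using compact_attains_sup[of S] by auto
    have s0': "r \<le> s0" "s0 < q" "x s0 = x r" "s0 \<in> J"
      using s0(1) xrq rqJ by (auto simp: S_def less_le)
    have left: "x t = x s0" if t: "t \<in> J" "t \<le> s0" for t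
    proof (cases "t \<le> r")
      case True
      then show ?thesis using xr[OF t(1)] s0' by simp
    next
      case False
      then show ?thesis using mono[of r t] mono[of t s0] t s0' \<open>r \<in> J\<close> by auto
    qed
    have incr: "x s0 < x t" if t: "t \<in> J" "s0 < t" for t
    proof (cases "t \<le> q")
      case True
      then have "t \<notin> S" using s0(2)[of t] t by auto
      then show ?thesis using mono[OF s0'(4) t(1)] t True s0' by (auto simp: S_def less_le)
    next
      case False
      then show ?thesis using mono[of q t] t neither xrq s0' by auto
    qed
    have right': "y t = y t'" if t: "t \<in> J" "t' \<in> J" "s0 < t" "t < t'" for t t'
      using no[of s0 t' t t] incr[of t] t s0' by auto
    \<comment> \<open>\<open>right'\<close> speaks only of times beyond \<open>s0\<close>;
      continuity includes the corner itself.\<close>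
    have "y s0 = y q"
    proof (rule eq_from_interior[of "{s0..q}" y "\<lambda>_. y q"])
      show "continuous_on {s0..q} y" using s0' rqJ by (intro continuous_on_subset[OF contJ(2)]) auto
      show "y t = y q" if "t \<in> interior {s0..q}" for t
        using right'[of t q] J_between[OF s0'(4) \<open>q \<in> J\<close>, of t] that neither by auto
    qed (use s0' in auto)
    then have right: "y t = y s0" if t: "t \<in> J" "s0 \<le> t" for t
    proof (cases t q rule: linorder_cases)
      case less
      then show ?thesis using right'[OF t(1) \<open>q \<in> J\<close>] t \<open>y s0 = y q\<close> by (cases "t = s0") auto
    next
      case greater
      then show ?thesis using right'[OF \<open>q \<in> J\<close> t(1)] s0'(2) \<open>y s0 = y q\<close> by simp
    qed simp
    obtain e where e: "0 < e" "\<And>h. \<bar>h\<bar> \<le> e \<Longrightarrow> s0 + h \<in> J" using J_room[OF s0'(4)] by blast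
    have e': "s0 - e \<in> J" "s0 + e \<in> J" using e(2)[of "-e"] e(2)[of e] e(1) by auto
    have Jl: "is_interval (J \<inter> {..s0})" and Jr: "is_interval (J \<inter> {s0..})"
      by (rule is_interval_Int[OF J_interval is_interval_ic] is_interval_Int[OF J_interval is_interval_ci])+
    have "\<exists>b. \<exists>c>0. \<forall>t\<in>J \<inter> {..s0}. y t = b - c * t"
      by (rule affine_where_x_constant[OF Jl, of "x s0" "s0 - e" s0]) (use e(1) e' s0'(4) in \<open>auto intro: left\<close>)
    then obtain b1 c where c: "0 < c" "\<And>t. t \<in> J \<inter> {..s0} \<Longrightarrow> y t = b1 - c * t" by blast
    have "\<exists>b. \<exists>c>0. \<forall>t\<in>J \<inter> {s0..}. x t = b + c * t"
      by (rule affine_where_y_constant[OF Jr, of "y s0" s0 "s0 + e"]) (use e(1) e' s0'(4) in \<open>auto intro: right\<close>)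
    then obtain a1 d where d: "0 < d" "\<And>t. t \<in> J \<inter> {s0..} \<Longrightarrow> x t = a1 + d * t" by blast
    have ys: "y s0 = b1 - c * s0" and xs: "x s0 = a1 + d * s0" using c(2)[of s0] d(2)[of s0] s0' by auto
    \<comment> \<open>The step before the corner has rate \<open>x s0 * c * e\<close>, the step
      after it \<open>y s0 * d * e\<close>; their equality is the relation
      \<open>a * c = b * d\<close> of (ii).\<close>
    have "path_rate x y (s0 - e) s0 = path_rate x y s0 (s0 + e)"
      by (rule rateJ) (use e(1) e' s0'(4) in auto)
    moreover have "x (s0 - e) = x s0" "y (s0 + e) = y s0" using left[OF e'(1)] right[OF e'(2)] e(1) by auto
    moreover have "y (s0 - e) = y s0 + c * e" "x (s0 + e) = x s0 + d * e"
      using c(2)[of "s0 - e"] d(2)[of "s0 + e"] e' e(1) ys xs by (auto simp: algebra_simps)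
    ultimately have acbd: "x s0 * c = y s0 * d" using e(1) by (simp add: path_rate_def)
    \<comment> \<open>Written with \<open>max\<close> and \<open>min\<close>, the broken lines are
      continuous by inspection, as the passage from \<open>J\<close> to \<open>T\<close>
      demands.\<close>
    have xJ: "x t = x s0 + d * max (t - s0) 0" if "t \<in> J" for t
      using left[of t] d(2)[of t] that xs by (cases "t \<le> s0") (auto simp: algebra_simps max_def)
    have yJ: "y t = y s0 - c * min (t - s0) 0" if "t \<in> J" for t
      using right[of t] c(2)[of t] that ys by (cases "t \<le> s0") (auto simp: algebra_simps min_def)
    have "x t = x s0 + d * max (t - s0) 0" if "t \<in> T" for t
      by (rule on_T_from_J[OF cont(1) _ xJ that]) (auto intro!: continuous_intros)
    moreover have "y t = y s0 - c * min (t - s0) 0" if "t \<in> T" for t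
      by (rule on_T_from_J[OF cont(2) _ yJ that]) (auto intro!: continuous_intros)
    ultimately have "cond_ii T x y s0 (x s0) (y s0) c d"
      using s0'(4) pos[OF s0'(4)] c(1) d(1) acbd by (auto simp: cond_ii_def J_def max_def min_def)
    then show ?thesis by blast
  qed
qed

text \<open>Strict monotonicity allows increments to be cancelled from the products in
  \<open>mixed_difference_shift\<close>. That the common factor is exponential in \<open>h\<close>
  comes from the logarithm of the increment over a fixed span \<open>u\<close>, which is affine in
  its starting point.\<close>

lemma cond_iii_or_iv:
  assumes strict: "\<And>s t. s \<in> J \<Longrightarrow> t \<in> J \<Longrightarrow> s < t \<Longrightarrow> x s < x t"
    "\<And>s t. s \<in> J \<Longrightarrow> t \<in> J \<Longrightarrow> s < t \<Longrightarrow> y t < y s"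
  shows "(\<exists>a b c d. cond_iii T x y a b c d) \<or> (\<exists>a b c. cond_iv T x y a b c)"
proof -
  have ratio: "(x (s' + h) - x (s + h)) * (x r' - x r) = (x (r' + h) - x (r + h)) * (x s' - x s)"
    if st: "s \<in> J" "s' + h \<in> J" "r \<in> J" "r' + h \<in> J" "s < s'" "r < r'" "0 \<le> h" for s s' r r' h
  proof -
    \<comment> \<open>Both \<open>x\<close>-increments are paired with the same
      \<open>y\<close>-increment, over a step of length \<open>e\<close> that starts to the right of
      both; it then cancels.\<close>
    define t where "t = max s' r'"
    have t: "t + h \<in> J" "s' \<le> t" "r' \<le> t" using st by (auto simp: t_def max_def)
    obtain e where e: "0 < e" "\<And>k. \<bar>k\<bar> \<le> e \<Longrightarrow> t + h + k \<in> J" using J_room[OF t(1)] by blast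
    have te: "t + e + h \<in> J" using e(2)[of e] e(1) by (simp add: algebra_simps)
    have inJ: "k \<in> J" if "k \<in> {s, s', s + h, s' + h, r, r', r + h, r' + h, t, t + e, t + h, t + e + h}" for k
      using that J_between[OF st(1) te, of k] J_between[OF st(3) te, of k] t st e(1) by auto
    have "(x (s' + h) - x (s + h)) * (y (t + h) - y (t + e + h)) = (x s' - x s) * (y t - y (t + e))"
      by (rule mixed_difference_shift) (use inJ st t e in auto)
    moreover have "(x (r' + h) - x (r + h)) * (y (t + h) - y (t + e + h)) = (x r' - x r) * (y t - y (t + e))"
      by (rule mixed_difference_shift) (use inJ st t e in auto)
    ultimately have "((x (s' + h) - x (s + h)) * (x r' - x r)) * (y (t + h) - y (t + e + h)) =
        ((x (r' + h) - x (r + h)) * (x s' - x s)) * (y (t + h) - y (t + e + h))"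
      by algebra
    moreover have "y (t + h) - y (t + e + h) \<noteq> 0"
      using strict(2)[of "t + h" "t + e + h"] inJ e(1) by simp
    ultimately show ?thesis by simp
  qed
  obtain p q where pq: "p \<in> J" "q \<in> J" "p < q" using J_two_points .
  define u where "u = (q - p) / 2"
  have u: "0 < u" "p + u + u = q" using pq by (auto simp: u_def field_simps)
  define I where "I = J \<inter> (\<lambda>t. t + u) -` J"
  \<comment> \<open>By \<open>ratio\<close>, the increments over \<open>u\<close> that start at
    \<open>t - h\<close>, \<open>t\<close> and \<open>t + h\<close> are in geometric progression, so
    their logarithms are in arithmetic progression.\<close>
  define f where "f = (\<lambda>t. ln (x (t + u) - x t))"
  have I: "is_interval I"
    unfolding is_interval_1
  proof (intro ballI allI impI)
    fix a b k assume "a \<in> I" "b \<in> I" "a \<le> k \<and> k \<le> b"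
    then show "k \<in> I" using J_between[of a b k] J_between[of "a + u" "b + u" "k + u"] by (simp add: I_def)
  qed
  have "continuous_on I f" unfolding f_def
  proof (intro continuous_intros)
    show "continuous_on I (\<lambda>t. x (t + u))"
      by (rule continuous_on_compose2[OF contJ(1)]) (auto intro!: continuous_intros simp: I_def)
    show "continuous_on I x" by (rule continuous_on_subset[OF contJ(1)]) (auto simp: I_def)
    show "\<forall>t\<in>I. x (t + u) - x t \<noteq> 0"
    proof
      fix t assume "t \<in> I"
      then show "x (t + u) - x t \<noteq> 0" using strict(1)[of t "t + u"] u(1) by (simp add: I_def)
    qed
  qed
  moreover have "f (t + h) - f t = f t - f (t - h)" if h: "0 < h" "t - h \<in> I" "t + h \<in> I" for t h
  proof -
    have t: "t \<in> I" using mem_is_interval_1_I[OF I h(2,3)] h by auto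
    have pos: "0 < x (k + u) - x k" if "k \<in> I" for k
      using strict(1)[of k "k + u"] that u by (simp add: I_def)
    have "(x (t - h + u + h) - x (t - h + h)) * (x (t + u) - x t) = (x (t + u + h) - x (t + h)) * (x (t - h + u) - x (t - h))"
      by (rule ratio) (use h t u in \<open>auto simp: I_def algebra_simps\<close>)
    then have "(x (t + u) - x t) * (x (t + u) - x t) = (x (t + h + u) - x (t + h)) * (x (t - h + u) - x (t - h))"
      by (simp add: algebra_simps)
    then have "ln ((x (t + u) - x t) * (x (t + u) - x t)) = ln ((x (t + h + u) - x (t + h)) * (x (t - h + u) - x (t - h)))"
      by simp
    then show ?thesis
      using pos[OF t] pos[OF h(2)] pos[OF h(3)] unfolding f_def by (subst (asm) (1 2) ln_mult_pos) auto
  qed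
  ultimately have "\<exists>A B. \<forall>t\<in>I. f t = A + B * t"
    by (intro affine_if_shift_invariant_increments[OF I, of _ 1]) auto
  then obtain A0 c where f: "\<And>t. t \<in> I \<Longrightarrow> f t = A0 + c * t" by blast
  have base: "x (p + u + h) - x (p + h) = exp (c * h) * (x (p + u) - x p)" if h: "0 < h" "h < u" for h
  proof -
    have in_I: "p \<in> I" "p + h \<in> I" using J_between[OF pq(1,2)] h u pq by (auto simp: I_def)
    have *: "x (k + u) - x k = exp (A0 + c * k)" if "k \<in> I" for k
    proof -
      have "0 < x (k + u) - x k" using strict(1)[of k "k + u"] that u(1) by (simp add: I_def)
      then have "x (k + u) - x k = exp (f k)" by (simp add: f_def)
      then show ?thesis by (simp only: f[OF that])
    qed
    have "x (p + h + u) - x (p + h) = exp (c * h) * (x (p + u) - x p)"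
      unfolding *[OF in_I(1)] *[OF in_I(2)] by (simp add: exp_add[symmetric] algebra_simps)
    then show ?thesis by (simp add: add_ac)
  qed
  \<comment> \<open>\<open>ratio\<close> carries the factor found at the reference increment from
    \<open>p\<close> to \<open>p + u\<close> over to every increment.\<close>
  have shift: "x (s' + h) - x (s + h) = exp (c * h) * (x s' - x s)"
    if "s \<in> J" "s' + h \<in> J" "s < s'" "0 < h" "h < u" for s s' h
  proof -
    have ph: "p + u + h \<in> J" using J_between[OF pq(1,2)] that u by auto
    have pu: "p + u \<in> J" using J_between[OF pq(1,2)] u by auto
    have "(x (s' + h) - x (s + h)) * (x (p + u) - x p) = (exp (c * h) * (x s' - x s)) * (x (p + u) - x p)"
      using ratio[of s s' h p "p + u"] ph that pq(1) u(1) base[OF that(4,5)] by simp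
    moreover have "x (p + u) - x p \<noteq> 0" using strict(1)[OF pq(1) pu] u by simp
    ultimately show ?thesis by simp
  qed
  have dx: "x (t + h) - x t = exp (c * h) * (x t - x (t - h))"
    if "0 < h" "h < u" "t - h \<in> J" "t + h \<in> J" for t h
    using shift[of "t - h" t h] that by simp
  \<comment> \<open>In the invariant product \<open>x\<close> scales by \<open>exp (c * h)\<close>,
    so \<open>y\<close> scales by the inverse. The \<open>x\<close>-increment used for this ends at
    \<open>t - h\<close>, which is why room of size \<open>e\<close> to its left is taken.\<close>
  have dy: "y (t + h) - y t = exp (- c * h) * (y t - y (t - h))"
    if h: "0 < h" "h < u" "t - h \<in> J" "t + h \<in> J" for t h
  proof -
    obtain e where e: "0 < e" "\<And>k. \<bar>k\<bar> \<le> e \<Longrightarrow> t - h + k \<in> J" using J_room[OF h(3)] by blast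
    have in_J: "t - h - e \<in> J" using e(2)[of "-e"] e(1) by simp
    have t: "t \<in> J" "t - e \<in> J" using J_between[OF in_J h(4)] h e(1) by auto
    have "(x (t - h + h) - x (t - h - e + h)) * (y (t - h + h) - y (t + h)) = (x (t - h) - x (t - h - e)) * (y (t - h) - y t)"
      by (rule mixed_difference_shift) (use in_J h e t in \<open>auto simp: algebra_simps\<close>)
    moreover have "x (t - h + h) - x (t - h - e + h) = exp (c * h) * (x (t - h) - x (t - h - e))"
      by (rule shift) (use in_J h e t in auto)
    moreover have "x (t - h) - x (t - h - e) \<noteq> 0" using strict(1)[OF in_J h(3)] e by simp
    ultimately have "exp (c * h) * (y t - y (t + h)) = y (t - h) - y t" by simp
    moreover have "exp (- c * h) * exp (c * h) = 1" by (simp flip: exp_add)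
    ultimately show ?thesis by algebra
  qed
  show ?thesis
  proof (cases "c = 0")
    case True
    have "\<exists>A B. \<forall>t\<in>J. x t = A + B * t"
      by (rule affine_if_shift_invariant_increments[OF J_interval contJ(1) u(1)]) (use dx True in auto)
    moreover have "\<exists>A B. \<forall>t\<in>J. y t = A + B * t"
      by (rule affine_if_shift_invariant_increments[OF J_interval contJ(2) u(1)]) (use dy True in auto)
    ultimately obtain A B C D where AB: "\<And>t. t \<in> J \<Longrightarrow> x t = A + B * t" "\<And>t. t \<in> J \<Longrightarrow> y t = C + D * t"
      by blast
    have "x p < x q" "y q < y p" using strict pq by auto
    then have "B * p < B * q" "D * q < D * p" using AB[OF pq(1)] AB[OF pq(2)] by auto
    then have BD: "0 < B" "0 < - D" using pq(3) by (auto simp: mult_less_cancel_left)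
    have "x t = A + B * t" if "t \<in> T" for t
      by (rule on_T_from_J[OF cont(1) _ AB(1) that]) (auto intro!: continuous_intros)
    moreover have "y t = C + D * t" if "t \<in> T" for t
      by (rule on_T_from_J[OF cont(2) _ AB(2) that]) (auto intro!: continuous_intros)
    ultimately have "cond_iii T x y A B C (- D)" using BD by (simp add: cond_iii_def)
    then show ?thesis by blast
  next
    case False
    have E: "exp (k * (t + h)) - exp (k * t) = exp (k * h) * (exp (k * t) - exp (k * (t - h)))" for k t h :: real
      by (simp add: algebra_simps flip: exp_add)
    have "\<exists>A B. \<forall>t\<in>J. x t = A + B * exp (c * t)"
      by (rule affine_in_second_difference_solution[OF J_interval contJ(1) _ _ u(1) _ dx E])
         (use False in \<open>auto intro!: continuous_intros inj_onI\<close>)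
    moreover have "\<exists>A B. \<forall>t\<in>J. y t = A + B * exp (- c * t)"
      by (rule affine_in_second_difference_solution[OF J_interval contJ(2) _ _ u(1) _ dy E])
         (use False in \<open>auto intro!: continuous_intros inj_onI\<close>)
    ultimately obtain A B C D where AB: "\<And>t. t \<in> J \<Longrightarrow> x t = A + B * exp (c * t)" "\<And>t. t \<in> J \<Longrightarrow> y t = C + D * exp (- c * t)"
      by blast
    have "x p < x q" "y q < y p" using strict pq by auto
    then have BD: "B \<noteq> 0" "D \<noteq> 0" using AB[OF pq(1)] AB[OF pq(2)] by auto
    \<comment> \<open>It remains to show \<open>A = C = 0\<close>. Comparing the rates from
      \<open>p\<close> and from \<open>p + h\<close>, over the spans \<open>h\<close> and
      \<open>2 * h\<close>, gives two equations; the second is the first with its sides multiplied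
      by \<open>1 + K\<close> and \<open>1 + G\<close>. Since \<open>G \<noteq> K\<close>, both
      sides vanish. The farthest point needed is \<open>p + 3 * h\<close>, hence the third.\<close>
    define h where "h = (q - p) / 3"
    have h: "0 < h" "p + 3 * h = q" using pq by (auto simp: h_def field_simps)
    have hJ: "p + h \<in> J" "p + 2 * h \<in> J" "p + 3 * h \<in> J" using J_between[OF pq(1,2)] h by auto
    define G where "G = exp (c * h)"
    have G: "0 < G" "G \<noteq> 1" using False h by (auto simp: G_def)
    have E: "exp (c * (p + real n * h)) = exp (c * p) * G ^ n"
      "exp (- c * (p + real n * h)) = exp (- c * p) * (1 / G) ^ n" for n
      by (auto simp: G_def exp_add[symmetric] exp_of_nat_mult[symmetric] exp_minus[symmetric] inverse_eq_divide[symmetric] algebra_simps)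
    have xs: "x (p + real n * h) = A + B * exp (c * p) * G ^ n"
      "y (p + real n * h) = C + D * exp (- c * p) * (1 / G) ^ n" if "n \<le> 3" for n
    proof -
      have "real n * h \<le> 3 * h" using that h by (intro mult_right_mono) auto
      then have "p + real n * h \<in> J" using J_between[OF pq(1,2)] h by auto
      then show "x (p + real n * h) = A + B * exp (c * p) * G ^ n"
        "y (p + real n * h) = C + D * exp (- c * p) * (1 / G) ^ n"
        by (simp_all only: AB E mult.assoc)
    qed
    define P where "P = exp (c * p)"
    define P' where "P' = exp (- c * p)"
    have PP: "P * P' = 1" "P > 0" "P' > 0" by (auto simp: P_def P'_def exp_add[symmetric])
    define K where "K = 1 / G"
    have K: "K * G = 1" "K > 0" using G by (auto simp: K_def)
    have xv: "x p = A + B * P" "x (p + h) = A + B * P * G" "x (p + 2 * h) = A + B * P * G ^ 2" "x (p + 3 * h) = A + B * P * G ^ 3"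
      using xs(1)[of 0] xs(1)[of 1] xs(1)[of 2] xs(1)[of 3] by (simp_all add: P_def)
    have yv: "y p = C + D * P'" "y (p + h) = C + D * P' * K" "y (p + 2 * h) = C + D * P' * K ^ 2" "y (p + 3 * h) = C + D * P' * K ^ 3"
      using xs(2)[of 0] xs(2)[of 1] xs(2)[of 2] xs(2)[of 3] by (simp_all add: P'_def K_def)
    have "path_rate x y p (p + h) = path_rate x y (p + h) (p + 2 * h)"
      "path_rate x y p (p + 2 * h) = path_rate x y (p + h) (p + 3 * h)"
      using hJ pq h by (auto intro!: rateJ)
    then have r1: "A * D * P' * (1 - K)^2 = B * C * P * (G - 1)^2"
      and r2: "A * D * P' * (1 - K)^2 * (1 + K) = B * C * P * (G - 1)^2 * (1 + G)"
      unfolding path_rate_def xv yv using PP(1) K(1) by algebra+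
    have "A * D * P' * (1 - K)^2 * (G - K) = 0" using r1 r2 by algebra
    moreover have "G \<noteq> K"
    proof
      assume "G = K"
      then have "G^2 = 1" using K by (simp add: power2_eq_square)
      then show False using G by (simp add: power2_eq_1_iff)
    qed
    moreover have "K \<noteq> 1" using K G by auto
    ultimately have A: "A = 0" using BD PP by simp
    then have C: "C = 0" using r1 BD PP G by simp
    have xT: "x t = B * exp (c * t)" if "t \<in> T" for t
      by (rule on_T_from_J[OF cont(1) _ _ that]) (use AB A in \<open>auto intro!: continuous_intros\<close>)
    moreover have yT: "y t = D * exp (- c * t)" if "t \<in> T" for t
      by (rule on_T_from_J[OF cont(2) _ _ that]) (use AB C in \<open>auto intro!: continuous_intros\<close>)
    moreover have pos': "0 < B" "0 < D"
      using pos[OF pq(1)] xT[OF J_T[OF pq(1)]] yT[OF J_T[OF pq(1)]] by (auto simp: zero_less_mult_iff)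
    moreover have "0 < c"
      using \<open>x p < x q\<close> xT[OF J_T[OF pq(1)]] xT[OF J_T[OF pq(2)]] pos' pq(3)
      by (auto simp: mult_less_cancel_left)
    ultimately have "cond_iv T x y B D c" by (simp add: cond_iv_def)
    then show ?thesis by blast
  qed
qed

theorem classification:
  "(\<exists>a b c. cond_i T x y a b c) \<or> (\<exists>s0 a b c d. cond_ii T x y s0 a b c d) \<or>
   (\<exists>a b c d. cond_iii T x y a b c d) \<or> (\<exists>a b c. cond_iv T x y a b c)"
proof (cases "\<exists>p\<in>J. \<exists>q\<in>J. p < q \<and> (x p = x q \<or> y p = y q)")
  case True
  then obtain p q where pq: "p \<in> J" "q \<in> J" "p < q" "x p = x q \<or> y p = y q" by blast
  show ?thesis using cond_i_or_ii no_increase_before_decrease[OF pq] by metis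
next
  case False
  then have "x s \<noteq> x t \<and> y s \<noteq> y t" if "s \<in> J" "t \<in> J" "s < t" for s t using that by blast
  then have "x s < x t" "y t < y s" if "s \<in> J" "t \<in> J" "s < t" for s t
    using mono[OF that(1,2)] antimono[OF that(1,2)] that by force+
  then show ?thesis using cond_iii_or_iv by blast
qed

end

section \<open>Rate and area gain of the four families of paths\<close>

definition shift_invariant_on :: "real set \<Rightarrow> (real \<Rightarrow> real \<Rightarrow> 'b) \<Rightarrow> bool" where
  "shift_invariant_on T f \<longleftrightarrow> (\<forall>s\<in>T. \<forall>t\<in>T. \<forall>s'\<in>T. \<forall>t'\<in>T.
     s < t \<longrightarrow> s' < t' \<longrightarrow> t - s = t' - s' \<longrightarrow> f s t = f s' t')"

lemma shift_invariant_onI: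
  assumes "\<And>s t. s \<in> T \<Longrightarrow> t \<in> T \<Longrightarrow> s < t \<Longrightarrow> f s t = g (t - s)"
  shows "shift_invariant_on T f"
  unfolding shift_invariant_on_def by (simp add: assms)

lemma shift_invariant_onD:
  "shift_invariant_on T f \<Longrightarrow> s \<in> T \<Longrightarrow> t \<in> T \<Longrightarrow> s' \<in> T \<Longrightarrow> t' \<in> T \<Longrightarrow>
    s < t \<Longrightarrow> s' < t' \<Longrightarrow> t - s = t' - s' \<Longrightarrow> f s t = f s' t'"
  unfolding shift_invariant_on_def by blast

text \<open>The difference \<open>A - B\<close>, the coefficient of \<open>Im \<psi>\<close> in the
  exponent of an increment.\<close>

definition path_area_gain :: "(real \<Rightarrow> real) \<Rightarrow> (real \<Rightarrow> real) \<Rightarrow> real \<Rightarrow> real \<Rightarrow> real" where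
  "path_area_gain x y s t = x t * y t - x s * y s"

lemma path_rate_cond_i:
  assumes "cond_i T x y a b c" "s \<in> T" "t \<in> T"
  shows "path_rate x y s t = phi_i a c (t - s)"
proof -
  consider "\<forall>t\<in>T. x t = a \<and> y t = b - c * t" | "\<forall>t\<in>T. x t = b + c * t \<and> y t = a"
    using assms by (auto simp: cond_i_def)
  then show ?thesis
    by cases (simp_all add: assms path_rate_def phi_i_def, simp_all add: algebra_simps)
qed

text \<open>The relation \<open>a * c = b * d\<close> equates the rates per unit time before and
  after the corner, so a step across the corner also depends on its length alone.\<close>

lemma path_rate_cond_ii:
  assumes "cond_ii T x y s0 a b c d" "s \<in> T" "t \<in> T" "s < t"
  shows "path_rate x y s t = phi_ii a c (t - s)"
proof -
  have ac: "a * c = b * d" using assms by (simp add: cond_ii_def)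
  have xy: "x r = (if r \<le> s0 then a else a + d * (r - s0))" "y r = (if r \<le> s0 then b - c * (r - s0) else b)"
    if "r \<in> T" for r
    using assms(1) that by (auto simp: cond_ii_def)
  consider "t \<le> s0" | "s \<le> s0" "s0 < t" | "s0 < s" using assms by linarith
  then show ?thesis
  proof cases
    case 1
    then show ?thesis using assms by (simp add: path_rate_def xy phi_ii_def algebra_simps)
  next
    case 2
    then have "path_rate x y s t = (b * d) * (t - s0) + (a * c) * (s0 - s)"
      using assms by (simp add: path_rate_def xy algebra_simps)
    then show ?thesis by (simp add: ac[symmetric] phi_ii_def algebra_simps)
  next
    case 3
    then have "path_rate x y s t = (b * d) * (t - s)"
      using assms by (simp add: path_rate_def xy algebra_simps)
    then show ?thesis by (simp add: ac[symmetric] phi_ii_def)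
  qed
qed

lemma path_rate_cond_iii:
  assumes "cond_iii T x y a b c d" "s \<in> T" "t \<in> T"
  shows "path_rate x y s t = phi_iii a b c d (t - s)"
proof -
  have xy: "x r = a + b * r" "y r = c - d * r" if "r \<in> T" for r
    using assms(1) that by (auto simp: cond_iii_def)
  show ?thesis
    unfolding path_rate_def phi_iii_def xy[OF assms(2)] xy[OF assms(3)]
    by (simp add: power2_eq_square algebra_simps)
qed

lemma path_rate_cond_iv:
  assumes "cond_iv T x y a b c" "s \<in> T" "t \<in> T"
  shows "path_rate x y s t = phi_iv a b c (t - s)"
proof -
  have xy: "x r = a * exp (c * r)" "y r = b * exp (- c * r)" if "r \<in> T" for r
    using assms(1) that by (auto simp: cond_iv_def)
  have "exp (- c * t) * exp (c * t) = 1" "exp (c * s) * exp (- c * s) = 1"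
    "exp (- c * (t - s)) = exp (- c * t) * exp (c * s)"
    by (simp_all add: algebra_simps flip: exp_add)
  then show ?thesis unfolding path_rate_def phi_iv_def xy[OF assms(2)] xy[OF assms(3)] by algebra
qed

lemma path_area_gain_cond_i:
  assumes "cond_i T x y a b c"
  shows "shift_invariant_on T (path_area_gain x y)"
proof -
  consider "\<forall>t\<in>T. x t = a \<and> y t = b - c * t" | "\<forall>t\<in>T. x t = b + c * t \<and> y t = a"
    using assms by (auto simp: cond_i_def)
  then show ?thesis
  proof cases
    case 1
    then show ?thesis
      by (intro shift_invariant_onI[where g = "\<lambda>u. - (a * c * u)"]) (simp add: path_area_gain_def, simp add: algebra_simps)
  next
    case 2
    then show ?thesis
      by (intro shift_invariant_onI[where g = "\<lambda>u. a * c * u"]) (simp add: path_area_gain_def, simp add: algebra_simps)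
  qed
qed

lemma path_area_gain_cond_iv:
  assumes "cond_iv T x y a b c" "s \<in> T" "t \<in> T"
  shows "path_area_gain x y s t = 0"
proof -
  have "x r * y r = a * b" if "r \<in> T" for r
  proof -
    have "x r = a * exp (c * r)" "y r = b * exp (- c * r)" using assms(1) that by (auto simp: cond_iv_def)
    moreover have "exp (c * r) * exp (- c * r) = 1" by (simp flip: exp_add)
    ultimately show ?thesis by algebra
  qed
  then show ?thesis using assms by (simp add: path_area_gain_def)
qed

lemma interior_symmetric_neighbours:
  assumes "(s0::real) \<in> interior T"
  obtains h where "0 < h" "s0 - h \<in> T" "s0 \<in> T" "s0 + h \<in> T"
proof -
  obtain e where "0 < e" "cball s0 e \<subseteq> T" using assms by (auto simp: mem_interior_cball)
  then show ?thesis using that[of e] by (auto simp: subset_eq dist_real_def)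
qed

text \<open>The product \<open>x * y\<close> falls before the corner and rises after it, so two
  steps of equal length that meet at \<open>s0\<close> have gains of opposite sign.\<close>

lemma not_shift_invariant_area_gain_ii:
  assumes c: "cond_ii T x y s0 a b c d"
  shows "\<not> shift_invariant_on T (path_area_gain x y)"
proof
  assume inv: "shift_invariant_on T (path_area_gain x y)"
  have "s0 \<in> interior T" using c by (simp add: cond_ii_def)
  then obtain h where h: "0 < h" "s0 - h \<in> T" "s0 \<in> T" "s0 + h \<in> T"
    using interior_symmetric_neighbours by blast
  have "path_area_gain x y (s0 - h) s0 = path_area_gain x y s0 (s0 + h)"
    by (rule shift_invariant_onD[OF inv]) (use h in auto)
  moreover have "path_area_gain x y (s0 - h) s0 = - (a * c * h)" "path_area_gain x y s0 (s0 + h) = d * b * h"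
    using c h by (auto simp: cond_ii_def path_area_gain_def) (simp_all add: algebra_simps)
  moreover have "0 < a * c * h" "0 < d * b * h" using c h by (auto simp: cond_ii_def)
  ultimately show False by linarith
qed

text \<open>Here \<open>x * y\<close> is a strictly concave quadratic, so adjacent steps of equal
  length have different gains.\<close>

lemma not_shift_invariant_area_gain_iii:
  assumes "decreasing_path T x y" and c: "cond_iii T x y a b c d"
  shows "\<not> shift_invariant_on T (path_area_gain x y)"
proof
  assume inv: "shift_invariant_on T (path_area_gain x y)"
  obtain s0 where "s0 \<in> interior T" using decreasing_path_subset_closure_interior(2)[OF assms(1)] by blast
  then obtain h where h: "0 < h" "s0 - h \<in> T" "s0 \<in> T" "s0 + h \<in> T"
    using interior_symmetric_neighbours by blast
  have "path_area_gain x y (s0 - h) s0 = path_area_gain x y s0 (s0 + h)"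
    by (rule shift_invariant_onD[OF inv]) (use h in auto)
  moreover have "path_area_gain x y (s0 - h) s0 - path_area_gain x y s0 (s0 + h) = 2 * (b * d * h * h)"
    using c h by (simp add: cond_iii_def path_area_gain_def) (simp add: algebra_simps)
  moreover have "0 < b * d * h * h" using c h by (auto simp: cond_iii_def)
  ultimately show False by linarith
qed

lemma shift_invariant_rate_iff:
  assumes path: "decreasing_path T x y"
  shows "shift_invariant_on T (path_rate x y) \<longleftrightarrow>
    (\<exists>a b c. cond_i T x y a b c) \<or> (\<exists>s0 a b c d. cond_ii T x y s0 a b c d) \<or>
    (\<exists>a b c d. cond_iii T x y a b c d) \<or> (\<exists>a b c. cond_iv T x y a b c)"
proof
  assume inv: "shift_invariant_on T (path_rate x y)"
  interpret stationary_path T x y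
  proof
    show "path_rate x y s t = path_rate x y s' t'"
      if "s \<in> T" "t \<in> T" "s' \<in> T" "t' \<in> T" "s < t" "s' < t'" "t - s = t' - s'" for s t s' t'
      using shift_invariant_onD[OF inv that] .
  qed (rule path)
  show "(\<exists>a b c. cond_i T x y a b c) \<or> (\<exists>s0 a b c d. cond_ii T x y s0 a b c d) \<or>
    (\<exists>a b c d. cond_iii T x y a b c d) \<or> (\<exists>a b c. cond_iv T x y a b c)"
    by (rule classification)
next
  have "shift_invariant_on T (path_rate x y)" if "cond_i T x y a b c" for a b c
    by (rule shift_invariant_onI) (rule path_rate_cond_i[OF that])
  moreover have "shift_invariant_on T (path_rate x y)" if "cond_ii T x y s0 a b c d" for s0 a b c d
    by (rule shift_invariant_onI) (rule path_rate_cond_ii[OF that])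
  moreover have "shift_invariant_on T (path_rate x y)" if "cond_iii T x y a b c d" for a b c d
    by (rule shift_invariant_onI) (rule path_rate_cond_iii[OF that])
  moreover have "shift_invariant_on T (path_rate x y)" if "cond_iv T x y a b c" for a b c
    by (rule shift_invariant_onI) (rule path_rate_cond_iv[OF that])
  moreover assume "(\<exists>a b c. cond_i T x y a b c) \<or> (\<exists>s0 a b c d. cond_ii T x y s0 a b c d) \<or>
    (\<exists>a b c d. cond_iii T x y a b c d) \<or> (\<exists>a b c. cond_iv T x y a b c)"
  ultimately show "shift_invariant_on T (path_rate x y)" by blast
qed

lemma shift_invariant_rate_and_gain_iff:
  assumes path: "decreasing_path T x y"
  shows "shift_invariant_on T (path_rate x y) \<and> shift_invariant_on T (path_area_gain x y) \<longleftrightarrow>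
    (\<exists>a b c. cond_i T x y a b c) \<or> (\<exists>a b c. cond_iv T x y a b c)"
proof
  show "(\<exists>a b c. cond_i T x y a b c) \<or> (\<exists>a b c. cond_iv T x y a b c)"
    if "shift_invariant_on T (path_rate x y) \<and> shift_invariant_on T (path_area_gain x y)"
    using that not_shift_invariant_area_gain_ii not_shift_invariant_area_gain_iii[OF path]
    unfolding shift_invariant_rate_iff[OF path] by blast
  show "shift_invariant_on T (path_rate x y) \<and> shift_invariant_on T (path_area_gain x y)"
    if "(\<exists>a b c. cond_i T x y a b c) \<or> (\<exists>a b c. cond_iv T x y a b c)"
  proof
    show "shift_invariant_on T (path_rate x y)" unfolding shift_invariant_rate_iff[OF path] using that by blast
    have "shift_invariant_on T (path_area_gain x y)" if "cond_iv T x y a b c" for a b c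
      by (rule shift_invariant_onI[where g = "\<lambda>_. 0"]) (rule path_area_gain_cond_iv[OF that])
    then show "shift_invariant_on T (path_area_gain x y)" using that path_area_gain_cond_i by blast
  qed
qed

section \<open>Characteristic functions determine laws\<close>

lemma cis_measurable [measurable]: "cis \<in> borel_measurable borel"
  by (intro borel_measurable_continuous_onI continuous_intros)

text \<open>Uniqueness is a predicate on the type so that it can be a hypothesis:
  \<open>charfun_joint\<close> is used once with the real line, to reach all Euclidean spaces, and
  once with the state space of the process, to reach its finite-dimensional laws.\<close>

definition charfun_determines :: "'b::euclidean_space itself \<Rightarrow> bool" where
  "charfun_determines _ \<longleftrightarrow> (\<forall>(\<mu>::'b measure) \<nu>. prob_space \<mu> \<longrightarrow> prob_space \<nu> \<longrightarrow>
     sets \<mu> = sets borel \<longrightarrow> sets \<nu> = sets borel \<longrightarrow>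
     (\<forall>z. (\<integral>u. cis (z \<bullet> u) \<partial>\<mu>) = (\<integral>u. cis (z \<bullet> u) \<partial>\<nu>)) \<longrightarrow> \<mu> = \<nu>)"

lemma charfun_determines_real: "charfun_determines TYPE(real)"
  unfolding charfun_determines_def
proof (intro allI impI)
  fix \<mu> \<nu> :: "real measure"
  assume a: "prob_space \<mu>" "prob_space \<nu>" "sets \<mu> = sets borel" "sets \<nu> = sets borel"
    "\<forall>z. (\<integral>u. cis (z \<bullet> u) \<partial>\<mu>) = (\<integral>u. cis (z \<bullet> u) \<partial>\<nu>)"
  have "char \<mu> = char \<nu>"
    using a(5) by (intro ext) (simp add: char_def cis_conv_exp)
  moreover have "real_distribution \<mu>" "real_distribution \<nu>"
    using a by (auto simp: real_distribution_def real_distribution_axioms_def)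
  ultimately show "\<mu> = \<nu>" by (intro Levy_uniqueness)
qed

lemma (in prob_space) integrable_bounded_by_1:
  fixes f :: "'a \<Rightarrow> 'c::{banach, second_countable_topology}"
  assumes "f \<in> borel_measurable M" "\<And>\<omega>. norm (f \<omega>) \<le> 1"
  shows "integrable M f"
  using assms by (intro integrable_const_bound[of _ 1]) auto

text \<open>The weight \<open>2 + Re W\<close> is positive, so it tilts the two laws into genuine measures, to which
  uniqueness applies after normalisation.\<close>

definition tilted_law :: "real \<Rightarrow> 'd measure \<Rightarrow> ('d \<Rightarrow> complex) \<Rightarrow> ('d \<Rightarrow> 'b::euclidean_space) \<Rightarrow> 'b measure" where
  "tilted_law m P w u = distr (density P (\<lambda>\<omega>. ennreal ((2 + Re (w \<omega>)) / m))) borel u"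

lemma tilted_law:
  fixes P :: "'d measure" and w :: "'d \<Rightarrow> complex" and u :: "'d \<Rightarrow> 'b::euclidean_space"
  assumes P: "prob_space P" and wm[measurable]: "w \<in> borel_measurable P" "u \<in> borel_measurable P"
    and w: "\<And>\<omega>. norm (w \<omega>) \<le> 1" and mP: "m = (\<integral>\<omega>. 2 + Re (w \<omega>) \<partial>P)" and m: "m > 0"
  shows "prob_space (tilted_law m P w u)" "sets (tilted_law m P w u) = sets borel"
    "\<And>f::'b \<Rightarrow> complex. f \<in> borel_measurable borel \<Longrightarrow> (\<And>v. norm (f v) \<le> 1) \<Longrightarrow>
       (\<integral>v. f v \<partial>tilted_law m P w u) = (2 * (\<integral>\<omega>. f (u \<omega>) \<partial>P) + (\<integral>\<omega>. of_real (Re (w \<omega>)) * f (u \<omega>) \<partial>P)) / m"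
proof -
  interpret P: prob_space P by fact
  have Rew: "\<bar>Re (w \<omega>)\<bar> \<le> 1" for \<omega> using w abs_Re_le_cmod order_trans by blast
  have nn: "0 \<le> (2 + Re (w \<omega>)) / m" for \<omega> using Rew[of \<omega>] m by (auto simp: abs_le_iff)
  have iw: "integrable P (\<lambda>\<omega>. Re (w \<omega>))" by (rule P.integrable_bounded_by_1) (use Rew in auto)
  have "prob_space (density P (\<lambda>\<omega>. ennreal ((2 + Re (w \<omega>)) / m)))"
  proof
    have "(\<integral>\<^sup>+\<omega>. ennreal ((2 + Re (w \<omega>)) / m) \<partial>P) = ennreal (\<integral>\<omega>. (2 + Re (w \<omega>)) / m \<partial>P)"
      using iw nn by (intro nn_integral_eq_integral) auto
    also have "\<dots> = 1" using m by (simp add: mP[symmetric])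
    finally show "emeasure (density P (\<lambda>\<omega>. ennreal ((2 + Re (w \<omega>)) / m)))
        (space (density P (\<lambda>\<omega>. ennreal ((2 + Re (w \<omega>)) / m)))) = 1"
      by (simp add: emeasure_density cong: nn_integral_cong)
  qed
  then show "prob_space (tilted_law m P w u)" unfolding tilted_law_def by (rule prob_space.prob_space_distr) simp
  show "sets (tilted_law m P w u) = sets borel" by (simp add: tilted_law_def)
  fix f :: "'b \<Rightarrow> complex" assume [measurable]: "f \<in> borel_measurable borel" and f: "\<And>v. norm (f v) \<le> 1"
  have if1: "integrable P (\<lambda>\<omega>. f (u \<omega>))" by (rule P.integrable_bounded_by_1) (use f in auto)
  have if2: "integrable P (\<lambda>\<omega>. of_real (Re (w \<omega>)) * f (u \<omega>))"
    by (rule P.integrable_bounded_by_1) (use Rew f in \<open>auto simp: norm_mult intro!: mult_le_one\<close>)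
  have "(\<integral>v. f v \<partial>tilted_law m P w u) = (\<integral>\<omega>. ((2 + Re (w \<omega>)) / m) *\<^sub>R f (u \<omega>) \<partial>P)"
    unfolding tilted_law_def using nn by (simp add: integral_distr integral_density)
  also have "\<dots> = (\<integral>\<omega>. (2 * f (u \<omega>) + of_real (Re (w \<omega>)) * f (u \<omega>)) / m \<partial>P)"
    by (intro Bochner_Integration.integral_cong) (auto simp: scaleR_conv_of_real algebra_simps)
  also have "\<dots> = (2 * (\<integral>\<omega>. f (u \<omega>) \<partial>P) + (\<integral>\<omega>. of_real (Re (w \<omega>)) * f (u \<omega>) \<partial>P)) / m"
    using if1 if2 by simp
  finally show "(\<integral>v. f v \<partial>tilted_law m P w u) = (2 * (\<integral>\<omega>. f (u \<omega>) \<partial>P) + (\<integral>\<omega>. of_real (Re (w \<omega>)) * f (u \<omega>) \<partial>P)) / m" .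
qed

text \<open>The tilted laws on the two sides have equal characteristic functions, and so have the
  plain laws. Uniqueness identifies both pairs; evaluating at \<open>A\<close> and subtracting twice
  the plain law leaves the part weighted by \<open>Re W\<close>.\<close>

lemma charfun_weighted_Re:
  fixes U :: "'a \<Rightarrow> 'b::euclidean_space" and V :: "'c \<Rightarrow> 'b"
  assumes det: "charfun_determines TYPE('b)" and M: "prob_space M" and N: "prob_space N"
    and [measurable]: "U \<in> borel_measurable M" "V \<in> borel_measurable N"
    and [measurable]: "W \<in> borel_measurable M" "W' \<in> borel_measurable N"
    and W: "\<And>\<omega>. norm (W \<omega>) \<le> 1" "\<And>\<omega>. norm (W' \<omega>) \<le> 1"
    and cf: "\<And>z. (\<integral>\<omega>. cis (z \<bullet> U \<omega>) \<partial>M) = (\<integral>\<omega>. cis (z \<bullet> V \<omega>) \<partial>N)"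
    and wcf: "\<And>z. (\<integral>\<omega>. W \<omega> * cis (z \<bullet> U \<omega>) \<partial>M) = (\<integral>\<omega>. W' \<omega> * cis (z \<bullet> V \<omega>) \<partial>N)"
    and A: "A \<in> sets borel"
  shows "(\<integral>\<omega>. Re (W \<omega>) * indicator A (U \<omega>) \<partial>M) = (\<integral>\<omega>. Re (W' \<omega>) * indicator A (V \<omega>) \<partial>N)"
proof -
  interpret M: prob_space M by fact
  interpret N: prob_space N by fact
  note [measurable] = A
  have ReW: "\<bar>Re (W \<omega>)\<bar> \<le> 1" "\<bar>Re (W' \<omega>')\<bar> \<le> 1" for \<omega> \<omega>'
    using W abs_Re_le_cmod order_trans by blast+
  \<comment> \<open>\<open>Re w\<close> is the mean of \<open>w\<close> and its conjugate, and the
    conjugate contributes the conjugate of the weighted characteristic function at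
    \<open>- z\<close>.\<close>
  have Re_cf: "(\<integral>\<omega>. of_real (Re (w \<omega>)) * cis (z \<bullet> u \<omega>) \<partial>P) =
      ((\<integral>\<omega>. w \<omega> * cis (z \<bullet> u \<omega>) \<partial>P) + cnj (\<integral>\<omega>. w \<omega> * cis (- z \<bullet> u \<omega>) \<partial>P)) / 2"
    if P: "prob_space P" and [measurable]: "w \<in> borel_measurable P" "u \<in> borel_measurable P"
      and w: "\<And>\<omega>. norm (w \<omega>) \<le> 1" for P :: "'d measure" and w and u :: "'d \<Rightarrow> 'b" and z
  proof -
    interpret P: prob_space P by fact
    have "of_real (Re (w \<omega>)) * cis (z \<bullet> u \<omega>) =
        (w \<omega> * cis (z \<bullet> u \<omega>) + cnj (w \<omega> * cis (- z \<bullet> u \<omega>))) / 2" for \<omega>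
      by (simp add: complex_eq_iff algebra_simps)
    moreover have i: "integrable P (\<lambda>\<omega>. w \<omega> * cis (v \<bullet> u \<omega>))" for v
      by (rule P.integrable_bounded_by_1) (use w in \<open>auto simp: norm_mult\<close>)
    moreover have "integrable P (\<lambda>\<omega>. cnj (w \<omega> * cis (- z \<bullet> u \<omega>)))"
      using i[of "- z"] by (rule integrable_cnj)
    ultimately show ?thesis
      by (simp only: Bochner_Integration.integral_cnj integral_divide_zero Bochner_Integration.integral_add)
  qed
  have Re_eq: "(\<integral>\<omega>. of_real (Re (W \<omega>)) * cis (z \<bullet> U \<omega>) \<partial>M) = (\<integral>\<omega>. of_real (Re (W' \<omega>)) * cis (z \<bullet> V \<omega>) \<partial>N)" for z
    by (simp only: Re_cf[OF M _ _ W(1)] Re_cf[OF N _ _ W(2)] assms wcf)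
  define m where "m = (\<integral>\<omega>. 2 + Re (W \<omega>) \<partial>M)"
  have iW: "integrable M (\<lambda>\<omega>. Re (W \<omega>))" "integrable N (\<lambda>\<omega>. Re (W' \<omega>))"
    using ReW by (auto intro!: M.integrable_bounded_by_1 N.integrable_bounded_by_1)
  have "complex_of_real (\<integral>\<omega>. Re (W \<omega>) \<partial>M) = complex_of_real (\<integral>\<omega>. Re (W' \<omega>) \<partial>N)"
    using Re_eq[of 0] by simp
  then have ReI: "(\<integral>\<omega>. Re (W \<omega>) \<partial>M) = (\<integral>\<omega>. Re (W' \<omega>) \<partial>N)" by (simp only: of_real_eq_iff)
  then have mN: "m = (\<integral>\<omega>. 2 + Re (W' \<omega>) \<partial>N)" using iW by (simp add: m_def M.prob_space N.prob_space)
  \<comment> \<open>The weight \<open>2 + Re W\<close> is at least 1, hence so is the normalising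
    constant; this is why 2 is added.\<close>
  have "(\<integral>\<omega>. 1 \<partial>M) \<le> m" unfolding m_def
    using iW ReW(1) by (intro integral_mono) (auto simp: abs_le_iff, smt (verit))
  then have m: "m > 0" by (simp add: M.prob_space)
  have tM: "prob_space (tilted_law m M W U)" "sets (tilted_law m M W U) = sets borel"
    "\<And>f::'b \<Rightarrow> complex. f \<in> borel_measurable borel \<Longrightarrow> (\<And>v. norm (f v) \<le> 1) \<Longrightarrow>
       (\<integral>v. f v \<partial>tilted_law m M W U) = (2 * (\<integral>\<omega>. f (U \<omega>) \<partial>M) + (\<integral>\<omega>. of_real (Re (W \<omega>)) * f (U \<omega>) \<partial>M)) / m"
    by (rule tilted_law[OF M _ _ W(1) m_def m]; simp)+
  have tN: "prob_space (tilted_law m N W' V)" "sets (tilted_law m N W' V) = sets borel"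
    "\<And>f::'b \<Rightarrow> complex. f \<in> borel_measurable borel \<Longrightarrow> (\<And>v. norm (f v) \<le> 1) \<Longrightarrow>
       (\<integral>v. f v \<partial>tilted_law m N W' V) = (2 * (\<integral>\<omega>. f (V \<omega>) \<partial>N) + (\<integral>\<omega>. of_real (Re (W' \<omega>)) * f (V \<omega>) \<partial>N)) / m"
    by (rule tilted_law[OF N _ _ W(2) mN m]; simp)+
  have "(\<integral>u. cis (z \<bullet> u) \<partial>tilted_law m M W U) = (\<integral>u. cis (z \<bullet> u) \<partial>tilted_law m N W' V)" for z
    by (simp add: tM(3) tN(3) cf Re_eq)
  then have 1: "tilted_law m M W U = tilted_law m N W' V"
    using det tM tN unfolding charfun_determines_def by blast
  have 2: "distr M borel U = distr N borel V"
  proof -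
    have "(\<integral>u. cis (z \<bullet> u) \<partial>distr M borel U) = (\<integral>u. cis (z \<bullet> u) \<partial>distr N borel V)" for z
      by (simp add: integral_distr cf)
    moreover have "prob_space (distr M borel U)" "prob_space (distr N borel V)"
      by (auto intro!: M.prob_space_distr N.prob_space_distr)
    ultimately show ?thesis using det unfolding charfun_determines_def by (metis sets_distr)
  qed
  define f where "f = (\<lambda>u. complex_of_real (indicator A u))"
  have [measurable]: "f \<in> borel_measurable borel" unfolding f_def by measurable
  have f1: "norm (f v) \<le> 1" for v by (simp add: f_def indicator_def)
  have "(\<integral>v. f v \<partial>distr M borel U) = (\<integral>v. f v \<partial>distr N borel V)" by (simp only: 2)
  then have "(\<integral>\<omega>. f (U \<omega>) \<partial>M) = (\<integral>\<omega>. f (V \<omega>) \<partial>N)" by (simp add: integral_distr)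
  moreover have "(\<integral>v. f v \<partial>tilted_law m M W U) = (\<integral>v. f v \<partial>tilted_law m N W' V)" by (simp only: 1)
  ultimately have "(\<integral>\<omega>. of_real (Re (W \<omega>)) * f (U \<omega>) \<partial>M) = (\<integral>\<omega>. of_real (Re (W' \<omega>)) * f (V \<omega>) \<partial>N)"
    using m f1 by (simp add: tM(3) tN(3))
  then have "complex_of_real (\<integral>\<omega>. Re (W \<omega>) * indicator A (U \<omega>) \<partial>M) = complex_of_real (\<integral>\<omega>. Re (W' \<omega>) * indicator A (V \<omega>) \<partial>N)"
    by (simp only: f_def of_real_mult[symmetric] integral_complex_of_real)
  then show ?thesis by (simp only: of_real_eq_iff)
qed

text \<open>\<open>Re (- \<i> * W)\<close> is \<open>Im W\<close>, so the lemma for real parts,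
  applied to \<open>W\<close> and to \<open>- \<i> * W\<close>, covers a complex weight.\<close>

lemma charfun_weighted:
  fixes U :: "'a \<Rightarrow> 'b::euclidean_space" and V :: "'c \<Rightarrow> 'b"
  assumes det: "charfun_determines TYPE('b)" and M: "prob_space M" and N: "prob_space N"
    and [measurable]: "U \<in> borel_measurable M" "V \<in> borel_measurable N"
    and [measurable]: "W \<in> borel_measurable M" "W' \<in> borel_measurable N"
    and W: "\<And>\<omega>. norm (W \<omega>) \<le> 1" "\<And>\<omega>. norm (W' \<omega>) \<le> 1"
    and cf: "\<And>z. (\<integral>\<omega>. cis (z \<bullet> U \<omega>) \<partial>M) = (\<integral>\<omega>. cis (z \<bullet> V \<omega>) \<partial>N)"
    and wcf: "\<And>z. (\<integral>\<omega>. W \<omega> * cis (z \<bullet> U \<omega>) \<partial>M) = (\<integral>\<omega>. W' \<omega> * cis (z \<bullet> V \<omega>) \<partial>N)"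
    and A: "A \<in> sets borel"
  shows "(\<integral>\<omega>. indicator A (U \<omega>) * W \<omega> \<partial>M) = (\<integral>\<omega>. indicator A (V \<omega>) * W' \<omega> \<partial>N)"
proof -
  interpret M: prob_space M by fact
  interpret N: prob_space N by fact
  note [measurable] = A
  have Re: "(\<integral>\<omega>. Re (W \<omega>) * indicator A (U \<omega>) \<partial>M) = (\<integral>\<omega>. Re (W' \<omega>) * indicator A (V \<omega>) \<partial>N)"
    by (rule charfun_weighted_Re[OF det M N _ _ _ _ W cf wcf A]) simp_all
  have "(\<integral>\<omega>. Re (- \<i> * W \<omega>) * indicator A (U \<omega>) \<partial>M) = (\<integral>\<omega>. Re (- \<i> * W' \<omega>) * indicator A (V \<omega>) \<partial>N)"
  proof (rule charfun_weighted_Re[OF det M N _ _ _ _ _ _ cf _ A])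
    show "(\<integral>\<omega>. - \<i> * W \<omega> * cis (z \<bullet> U \<omega>) \<partial>M) = (\<integral>\<omega>. - \<i> * W' \<omega> * cis (z \<bullet> V \<omega>) \<partial>N)" for z
      using wcf[of z] by (simp add: mult.assoc)
  qed (use W in \<open>auto simp: norm_mult\<close>)
  then have Im: "(\<integral>\<omega>. Im (W \<omega>) * indicator A (U \<omega>) \<partial>M) = (\<integral>\<omega>. Im (W' \<omega>) * indicator A (V \<omega>) \<partial>N)" by simp
  have int: "integrable M (\<lambda>\<omega>. indicator A (U \<omega>) * W \<omega>)"
    by (rule M.integrable_bounded_by_1) (use W in \<open>auto simp: norm_mult indicator_def\<close>)
  have int': "integrable N (\<lambda>\<omega>. indicator A (V \<omega>) * W' \<omega>)"
    by (rule N.integrable_bounded_by_1) (use W in \<open>auto simp: norm_mult indicator_def\<close>)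
  have ind: "Re (indicator A v * w) = Re w * indicator A v" "Im (indicator A v * w) = Im w * indicator A v" for v w
    by (auto simp: indicator_def)
  show ?thesis
    by (rule complex_eqI) (simp_all only: integral_Re[OF int, symmetric] integral_Re[OF int', symmetric]
        integral_Im[OF int, symmetric] integral_Im[OF int', symmetric] ind Re Im)
qed

lemma prod_indicator_eq:
  "finite J \<Longrightarrow> (\<Prod>i\<in>J. indicator (A i) (f i)) = (of_bool (\<forall>i\<in>J. f i \<in> A i) :: complex)"
  by (induction J rule: finite_induct) (auto simp: indicator_def)

text \<open>Exponentials are turned into indicators one index at a time. At each stage
  \<open>charfun_weighted\<close> acts on the single vector \<open>U k\<close>, and all remaining
  factors, indicators and exponentials alike, form its weight.\<close>

lemma charfun_joint:
  fixes U :: "'i \<Rightarrow> 'a \<Rightarrow> 'b::euclidean_space" and V :: "'i \<Rightarrow> 'c \<Rightarrow> 'b"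
  assumes det: "charfun_determines TYPE('b)" and M: "prob_space M" and N: "prob_space N" and I: "finite I"
    and UV[measurable]: "\<And>i. U i \<in> borel_measurable M" "\<And>i. V i \<in> borel_measurable N"
    and cf: "\<And>z. (\<integral>\<omega>. cis (\<Sum>i\<in>I. z i \<bullet> U i \<omega>) \<partial>M) = (\<integral>\<omega>. cis (\<Sum>i\<in>I. z i \<bullet> V i \<omega>) \<partial>N)"
    and A: "\<And>i. i \<in> I \<Longrightarrow> A i \<in> sets borel"
  shows "measure M {\<omega> \<in> space M. \<forall>i\<in>I. U i \<omega> \<in> A i} = measure N {\<omega> \<in> space N. \<forall>i\<in>I. V i \<omega> \<in> A i}"
proof -
  interpret M: prob_space M by fact
  interpret N: prob_space N by fact
  have partial: "(\<integral>\<omega>. (\<Prod>i\<in>J. indicator (A i) (U i \<omega>)) * cis (\<Sum>i\<in>I - J. z i \<bullet> U i \<omega>) \<partial>M) =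
      (\<integral>\<omega>. (\<Prod>i\<in>J. indicator (A i) (V i \<omega>)) * cis (\<Sum>i\<in>I - J. z i \<bullet> V i \<omega>) \<partial>N)"
    if "J \<subseteq> I" "\<And>i. i \<in> I \<Longrightarrow> A i \<in> sets borel" for J z and A :: "'i \<Rightarrow> 'b set"
    using finite_subset[OF that(1) I] that
  proof (induction J arbitrary: z A rule: finite_induct)
    case empty
    then show ?case using cf by simp
  next
    case (insert k J)
    have k: "k \<in> I" using insert.prems by simp
    have split: "(\<Sum>i\<in>I - J. g i) = g k + (\<Sum>i\<in>I - insert k J. g i)" for g :: "'i \<Rightarrow> real"
    proof -
      have *: "I - J = insert k (I - insert k J)" using insert.hyps k by auto
      show ?thesis by (subst *) (use I in simp)
    qed
    have [measurable]: "i \<in> J \<Longrightarrow> A i \<in> sets borel" for i using insert.prems by auto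
    define WU where "WU \<omega> = (\<Prod>i\<in>J. indicator (A i) (U i \<omega>)) * cis (\<Sum>i\<in>I - insert k J. z i \<bullet> U i \<omega>)" for \<omega>
    define WV where "WV \<omega> = (\<Prod>i\<in>J. indicator (A i) (V i \<omega>)) * cis (\<Sum>i\<in>I - insert k J. z i \<bullet> V i \<omega>)" for \<omega>
    have "(\<integral>\<omega>. indicator (A k) (U k \<omega>) * WU \<omega> \<partial>M) = (\<integral>\<omega>. indicator (A k) (V k \<omega>) * WV \<omega> \<partial>N)"
    proof (rule charfun_weighted[OF det M N])
      show "WU \<in> borel_measurable M" "WV \<in> borel_measurable N"
        unfolding WU_def WV_def using insert.prems
        by (auto intro!: borel_measurable_times borel_measurable_prod measurable_compose[OF UV(1) borel_measurable_indicator]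
            measurable_compose[OF UV(2) borel_measurable_indicator] measurable_compose[OF _ cis_measurable]
            borel_measurable_sum borel_measurable_inner)
      show "cmod (WU \<omega>) \<le> 1" "cmod (WV \<omega>') \<le> 1" for \<omega> \<omega>'
        unfolding WU_def WV_def by (simp_all add: norm_mult prod_indicator_eq[OF insert.hyps(1)])
      \<comment> \<open>Frequencies that vanish off \<open>k\<close> give the marginal
        characteristic function.\<close>
      show "(\<integral>\<omega>. cis (v \<bullet> U k \<omega>) \<partial>M) = (\<integral>\<omega>. cis (v \<bullet> V k \<omega>) \<partial>N)" for v
      proof -
        have *: "(\<Sum>i\<in>I. (if i = k then v else 0) \<bullet> g i) = v \<bullet> g k" for g :: "'i \<Rightarrow> 'b"
          using I k by (simp add: if_distrib[of "\<lambda>u. u \<bullet> _"] sum.delta cong: if_cong)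
        show ?thesis using cf[of "\<lambda>i. if i = k then v else 0"] by (simp only: *)
      qed
      \<comment> \<open>This is the induction hypothesis with the frequency at \<open>k\<close>
        replaced by \<open>v\<close>, which is why \<open>z\<close> has to vary in it.\<close>
      show "(\<integral>\<omega>. WU \<omega> * cis (v \<bullet> U k \<omega>) \<partial>M) = (\<integral>\<omega>. WV \<omega> * cis (v \<bullet> V k \<omega>) \<partial>N)" for v
      proof -
        have *: "(\<Sum>i\<in>I - J. (z(k := v)) i \<bullet> g i) = v \<bullet> g k + (\<Sum>i\<in>I - insert k J. z i \<bullet> g i)" for g :: "'i \<Rightarrow> 'b"
          unfolding split by (auto intro!: sum.cong)
        have "(\<integral>\<omega>. (\<Prod>i\<in>J. indicator (A i) (U i \<omega>)) * cis (\<Sum>i\<in>I - J. (z(k := v)) i \<bullet> U i \<omega>) \<partial>M) =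
          (\<integral>\<omega>. (\<Prod>i\<in>J. indicator (A i) (V i \<omega>)) * cis (\<Sum>i\<in>I - J. (z(k := v)) i \<bullet> V i \<omega>) \<partial>N)"
          using insert.prems by (intro insert.IH) auto
        then show ?thesis unfolding * WU_def WV_def by (simp add: cis_mult[symmetric] mult_ac)
      qed
    qed (use insert.prems k in auto)
    then show ?case using insert.hyps by (simp add: WU_def WV_def mult.assoc)
  qed
  have fin: "(\<integral>\<omega>. (\<Prod>i\<in>I. indicator (A i) (f i \<omega>)) * cis (\<Sum>i\<in>I - I. z i \<bullet> f i \<omega>) \<partial>P) =
      complex_of_real (measure P {\<omega> \<in> space P. \<forall>i\<in>I. f i \<omega> \<in> A i})"
    if f: "\<And>i. f i \<in> borel_measurable P" and P: "prob_space P" for P :: "'d measure" and f :: "'i \<Rightarrow> 'd \<Rightarrow> 'b" and z :: "'i \<Rightarrow> 'b"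
  proof -
    interpret P: prob_space P by fact
    let ?S = "{\<omega> \<in> space P. \<forall>i\<in>I. f i \<omega> \<in> A i}"
    have S: "?S \<in> sets P"
      by (rule sets.sets_Collect_finite_All[OF _ I]) (use f A measurable_sets_Collect in \<open>auto intro!: measurable_sets_Collect[OF f]\<close>)
    have "(\<integral>\<omega>. (\<Prod>i\<in>I. indicator (A i) (f i \<omega>)) * cis (\<Sum>i\<in>I - I. z i \<bullet> f i \<omega>) \<partial>P) =
      (\<integral>\<omega>. complex_of_real (indicator ?S \<omega>) \<partial>P)"
      by (rule Bochner_Integration.integral_cong[OF refl])
         (simp only: prod_indicator_eq[OF I] Diff_cancel sum.empty, simp add: indicator_def)
    then show ?thesis using S by (simp add: integral_complex_of_real)
  qed
  have "complex_of_real (measure M {\<omega> \<in> space M. \<forall>i\<in>I. U i \<omega> \<in> A i}) = complex_of_real (measure N {\<omega> \<in> space N. \<forall>i\<in>I. V i \<omega> \<in> A i})"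
    using partial[of I A "\<lambda>_. 0", OF order_refl A]
    unfolding fin[of U, OF UV(1) M] fin[of V, OF UV(2) N] by simp
  then show ?thesis by (simp only: of_real_eq_iff)
qed

text \<open>A box is a finite set of conditions on real coordinates, whose joint characteristic
  function is that of the vector at \<open>\<Sum>b\<in>Basis. z b *\<^sub>R b\<close>. Boxes are
  stable under intersection and generate the Borel sets.\<close>

theorem charfun_determines: "charfun_determines TYPE('v::euclidean_space)"
  unfolding charfun_determines_def
proof (intro allI impI)
  fix \<mu> \<nu> :: "'v measure"
  assume a: "prob_space \<mu>" "prob_space \<nu>" and s: "sets \<mu> = sets borel" "sets \<nu> = sets borel"
    and cf: "\<forall>z. (\<integral>u. cis (z \<bullet> u) \<partial>\<mu>) = (\<integral>u. cis (z \<bullet> u) \<partial>\<nu>)"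
  interpret \<mu>: prob_space \<mu> by fact
  interpret \<nu>: prob_space \<nu> by fact
  have sp: "space \<mu> = UNIV" "space \<nu> = UNIV" using s[THEN sets_eq_imp_space_eq] by auto
  have box: "measure \<mu> (box l u) = measure \<nu> (box l u)" for l u
  proof -
    have *: "box l u = {v \<in> UNIV. \<forall>b\<in>Basis. v \<bullet> b \<in> {l \<bullet> b<..<u \<bullet> b}}" by (auto simp: box_def)
    have "measure \<mu> {v \<in> space \<mu>. \<forall>b\<in>Basis. v \<bullet> b \<in> {l \<bullet> b<..<u \<bullet> b}} =
        measure \<nu> {v \<in> space \<nu>. \<forall>b\<in>Basis. v \<bullet> b \<in> {l \<bullet> b<..<u \<bullet> b}}"
    proof (rule charfun_joint[OF charfun_determines_real a finite_Basis])
      show "(\<lambda>v. v \<bullet> b) \<in> borel_measurable \<mu>" "(\<lambda>v. v \<bullet> b) \<in> borel_measurable \<nu>" for b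
        by (auto simp: measurable_cong_sets[OF s(1) refl] measurable_cong_sets[OF s(2) refl])
      show "(\<integral>v. cis (\<Sum>b\<in>Basis. z b \<bullet> (v \<bullet> b)) \<partial>\<mu>) = (\<integral>v. cis (\<Sum>b\<in>Basis. z b \<bullet> (v \<bullet> b)) \<partial>\<nu>)" for z
      proof -
        have "(\<Sum>b\<in>Basis. z b \<bullet> (v \<bullet> b)) = (\<Sum>b\<in>Basis. z b *\<^sub>R b) \<bullet> v" for v :: 'v
          by (simp add: inner_sum_left inner_commute[of v])
        then show ?thesis using cf by simp
      qed
    qed simp
    then show ?thesis unfolding sp using * by simp
  qed
  show "\<mu> = \<nu>"
  proof (rule measure_eqI_generator_eq)
    let ?E = "range (\<lambda>(a, b). box a b::'v set)"
    show "Int_stable ?E" by (auto simp: Int_stable_def box_Int_box)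
    show "?E \<subseteq> Pow UNIV" "sets \<mu> = sigma_sets UNIV ?E" "sets \<nu> = sigma_sets UNIV ?E"
      by (simp_all add: borel_eq_box s)
    let ?A = "\<lambda>n::nat. box (- (real n *\<^sub>R One)) (real n *\<^sub>R One) :: 'v set"
    show "range ?A \<subseteq> ?E" "(\<Union>i. ?A i) = UNIV"
      unfolding UN_box_eq_UNIV by auto
    show "emeasure \<mu> (?A i) \<noteq> \<infinity>" for i by simp
    show "emeasure \<mu> B = emeasure \<nu> B" if "B \<in> ?E" for B
      using that box by (auto simp: \<mu>.emeasure_eq_measure \<nu>.emeasure_eq_measure)
  qed
qed

lemma distr_eq_iff_charfun:
  fixes U V :: "'a \<Rightarrow> 'v::euclidean_space"
  assumes M: "prob_space M" and [measurable]: "U \<in> borel_measurable M" "V \<in> borel_measurable M"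
  shows "distr M borel U = distr M borel V \<longleftrightarrow>
    (\<forall>z. (\<integral>\<omega>. cis (z \<bullet> U \<omega>) \<partial>M) = (\<integral>\<omega>. cis (z \<bullet> V \<omega>) \<partial>M))" (is "?L \<longleftrightarrow> ?R")
proof
  have *: "(\<integral>u. cis (z \<bullet> u) \<partial>distr M borel W) = (\<integral>\<omega>. cis (z \<bullet> W \<omega>) \<partial>M)"
    if [measurable]: "W \<in> borel_measurable M" for z and W :: "'a \<Rightarrow> 'v"
    by (simp add: integral_distr)
  show ?R if ?L
    using *[of U] *[of V] that by simp
  show ?L if ?R
  proof -
    have "prob_space (distr M borel U)" "prob_space (distr M borel V)"
      using M by (auto intro!: prob_space.prob_space_distr)
    moreover have "(\<integral>u. cis (z \<bullet> u) \<partial>distr M borel U) = (\<integral>u. cis (z \<bullet> u) \<partial>distr M borel V)" for z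
      using that by (simp add: *)
    ultimately show ?thesis
      using charfun_determines[where 'v = 'v] unfolding charfun_determines_def by simp
  qed
qed

section \<open>Two-parameter Levy processes\<close>

lemma cis_eq_1_small: "cis \<theta> = 1 \<Longrightarrow> \<bar>\<theta>\<bar> < 1 \<Longrightarrow> \<theta> = 0"
  using sin_zero_pi_iff[of \<theta>] pi_gt3 by (auto simp: complex_eq_iff)

text \<open>One value of \<open>r\<close> fixes the exponent only modulo multiples of
  \<open>2 * pi * \<i>\<close>; an \<open>r\<close> so small that the phase of the quotient stays
  below 1 removes the ambiguity.\<close>

lemma exp_scaleR_inject:
  assumes "\<And>r::real. 0 \<le> r \<Longrightarrow> exp (of_real r * a) = exp (of_real r * b)"
  shows "a = (b::complex)"
proof -
  define r where "r = 1 / (1 + \<bar>Im (a - b)\<bar>)"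
  have r: "r > 0" by (simp add: r_def add_pos_nonneg)
  have "exp (of_real r * (a - b)) = 1"
    using assms[of r] r by (simp add: right_diff_distrib exp_diff)
  then have 1: "of_real (exp (r * Re (a - b))) * cis (r * Im (a - b)) = 1"
    by (simp add: exp_eq_polar)
  then have "cmod (of_real (exp (r * Re (a - b))) * cis (r * Im (a - b))) = 1" by simp
  then have "exp (r * Re (a - b)) = 1" by (simp add: norm_mult)
  then have Re: "Re (a - b) = 0" using r by simp
  then have "cis (r * Im (a - b)) = 1" using 1 by simp
  moreover have "\<bar>r * Im (a - b)\<bar> < 1" by (simp add: r_def abs_mult divide_simps)
  ultimately have "r * Im (a - b) = 0" by (rule cis_eq_1_small)
  then show ?thesis using r Re by (simp add: complex_eq_iff)
qed

lemma cis_sum: "finite I \<Longrightarrow> cis (\<Sum>i\<in>I. f i) = (\<Prod>i\<in>I. cis (f i))"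
  by (induction I rule: finite_induct) (auto simp: cis_mult[symmetric])

text \<open>Equality case of the triangle inequality: after rotation by the conjugate mean, the real
  part is at most 1 and has mean 1, so it is 1 almost everywhere; a unit complex number with real
  part 1 is 1.\<close>

lemma (in prob_space) AE_const_if_norm_expectation_1:
  fixes f :: "'a \<Rightarrow> complex"
  assumes [measurable]: "f \<in> borel_measurable M" and f: "\<And>\<omega>. cmod (f \<omega>) = 1" and m: "cmod (expectation f) = 1"
  shows "AE \<omega> in M. f \<omega> = expectation f"
proof -
  define m where "m = expectation f"
  have int: "integrable M (\<lambda>\<omega>. cnj m * f \<omega>)"
    using f by (intro integrable_mult_right integrable_bounded_by_1) auto
  have mm: "cnj m * m = 1" using m by (simp add: m_def mult.commute complex_norm_square[symmetric])
  have le: "Re (cnj m * f \<omega>) \<le> 1" for \<omega>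
    using complex_Re_le_cmod[of "cnj m * f \<omega>"] f m by (simp add: norm_mult m_def)
  have "expectation (\<lambda>\<omega>. Re (cnj m * f \<omega>)) = Re (cnj m * m)"
    using integral_Re[OF int] by (simp add: m_def)
  also have "\<dots> = 1" by (simp only: mm one_complex.simps)
  finally have "expectation (\<lambda>\<omega>. 1 - Re (cnj m * f \<omega>)) = 0"
    by (subst Bochner_Integration.integral_diff[OF _ integrable_Re[OF int]]) (auto simp only: prob_space integrable_const lebesgue_integral_const, simp)
  moreover have "integrable M (\<lambda>\<omega>. 1 - Re (cnj m * f \<omega>))"
    using integrable_Re[OF int] by (intro Bochner_Integration.integrable_diff) auto
  ultimately have "AE \<omega> in M. 1 - Re (cnj m * f \<omega>) = 0"
    using le by (subst (asm) integral_nonneg_eq_0_iff_AE) auto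
  then show ?thesis
  proof eventually_elim
    case (elim \<omega>)
    then have Re: "Re (cnj m * f \<omega>) = 1" by simp
    have "(Re (cnj m * f \<omega>))\<^sup>2 + (Im (cnj m * f \<omega>))\<^sup>2 = 1"
      using f[of \<omega>] m by (simp only: cmod_power2[symmetric] norm_mult m_def complex_mod_cnj) simp
    then have "Im (cnj m * f \<omega>) = 0" using Re by simp
    then have 1: "cnj m * f \<omega> = 1" using Re by (simp add: complex_eq_iff)
    have "f \<omega> = (m * cnj m) * f \<omega>" using mm by (simp add: mult.commute)
    also have "\<dots> = m" by (simp only: mult.assoc 1 mult_1_right)
    finally show ?case by (simp add: m_def)
  qed
qed

lemma finite_set_in_grid:
  assumes "finite S" "\<And>s. s \<in> S \<Longrightarrow> (0::real) \<le> s"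
  shows "\<exists>(g::nat \<Rightarrow> real) n. mono g \<and> g 0 = 0 \<and> S \<subseteq> g ` {..n} \<and> range g \<subseteq> insert 0 S"
  using assms
proof (induction S rule: finite_linorder_max_induct)
  case empty
  show ?case by (intro exI[of _ "\<lambda>_. 0"]) (auto simp: mono_def)
next
  case (insert b A)
  have "\<exists>(g::nat \<Rightarrow> real) n. mono g \<and> g 0 = 0 \<and> A \<subseteq> g ` {..n} \<and> range g \<subseteq> insert 0 A"
    by (rule insert.IH) (simp add: insert.prems)
  then obtain g :: "nat \<Rightarrow> real" and n where g: "mono g" "g 0 = 0" "A \<subseteq> g ` {..n}" "range g \<subseteq> insert 0 A"
    by blast
  define g' where "g' = (\<lambda>i. if i \<le> n then g i else b)"
  have gb: "g i \<le> b" for i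
  proof -
    have "g i \<in> insert 0 A" using g(4) by auto
    then show ?thesis using insert.hyps(2) insert.prems[of b] by auto
  qed
  have "mono g'" unfolding g'_def using gb monoD[OF g(1)] by (auto simp: mono_def)
  moreover have "g' 0 = 0" using g by (simp add: g'_def)
  moreover have "insert b A \<subseteq> g' ` {..Suc n}"
  proof -
    have "b = g' (Suc n)" by (simp add: g'_def)
    moreover have "g ` {..n} \<subseteq> g' ` {..Suc n}" 
    proof
      fix v assume "v \<in> g ` {..n}"
      then obtain i where "i \<le> n" "v = g' i" by (auto simp: g'_def)
      then show "v \<in> g' ` {..Suc n}" by auto
    qed
    ultimately show ?thesis using g(3) by auto
  qed
  moreover have "range g' \<subseteq> insert 0 (insert b A)" using g(4) by (auto simp: g'_def)
  ultimately show ?case by blast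
qed

lemma grid_cells_disjoint:
  fixes g h :: "nat \<Rightarrow> real"
  assumes "mono g" "mono h" "(i, j) \<noteq> (i', j')"
  shows "rect_set (g i, h j) (g (Suc i), h (Suc j)) \<inter> rect_set (g i', h j') (g (Suc i'), h (Suc j')) = {}"
proof -
  have cell: "k = k'" if "mono f" "f k < u" "u \<le> f (Suc k)" "f k' < u" "u \<le> f (Suc k')"
    for f :: "nat \<Rightarrow> real" and k k' u
  proof (rule ccontr)
    assume "k \<noteq> k'"
    then have "Suc k \<le> k' \<or> Suc k' \<le> k" by auto
    then show False using monoD[OF \<open>mono f\<close>] that by (meson not_less order_trans)
  qed
  show ?thesis using cell[OF assms(1)] cell[OF assms(2)] assms(3) by (auto simp: rect_set_def)
qed

lemma sum_grid_cells:
  "(\<Sum>i<a. \<Sum>j<b. incr X (g i, h j) (g (Suc i), h (Suc j)) \<omega>) =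
    X (g a, h b) \<omega> - X (g 0, h b) \<omega> - X (g a, h 0) \<omega> + X (g 0, h 0) \<omega>"
proof -
  have "(\<Sum>j<b. incr X (g i, h j) (g (Suc i), h (Suc j)) \<omega>) =
      (X (g (Suc i), h b) \<omega> - X (g (Suc i), h 0) \<omega>) - (X (g i, h b) \<omega> - X (g i, h 0) \<omega>)" for i
  proof -
    have "(\<Sum>j<b. incr X (g i, h j) (g (Suc i), h (Suc j)) \<omega>) =
      (\<Sum>j<b. (X (g (Suc i), h (Suc j)) \<omega> - X (g i, h (Suc j)) \<omega>) - (X (g (Suc i), h j) \<omega> - X (g i, h j) \<omega>))"
      by (intro sum.cong) (auto simp: incr_def)
    then show ?thesis
      using sum_lessThan_telescope[of "\<lambda>j. X (g (Suc i), h j) \<omega> - X (g i, h j) \<omega>" b] by simp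
  qed
  then show ?thesis
    using sum_lessThan_telescope[of "\<lambda>i. X (g i, h b) \<omega> - X (g i, h 0) \<omega>" a] by simp
qed

locale tplp =
  fixes M :: "'a measure" and X :: "real \<times> real \<Rightarrow> 'a \<Rightarrow> 'v::euclidean_space" and \<psi> :: "'v \<Rightarrow> complex"
  assumes TPLP: "TPLP M X" and exponent: "TPLP_exponent M X \<psi>"
begin

sublocale prob_space M
  using TPLP by (simp add: TPLP_def)

lemma X_measurable [measurable]: "X t \<in> borel_measurable M"
  using TPLP unfolding TPLP_def by blast

lemma incr_measurable [measurable]: "incr X s t \<in> borel_measurable M"
  unfolding incr_def[abs_def] by measurable

lemma AE_axes: "AE \<omega> in M. \<forall>a\<ge>0. X (a, 0) \<omega> = 0 \<and> X (0, a) \<omega> = 0"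
proof -
  have "AE \<omega> in M. \<forall>t\<in>quad. (fst t = 0 \<or> snd t = 0) \<longrightarrow> X t \<omega> = 0"
    using TPLP unfolding TPLP_def by blast
  then show ?thesis by eventually_elim (auto simp: quad_def)
qed

lemma charfun_rect:
  "is_rect s t \<Longrightarrow> expectation (\<lambda>\<omega>. cis (z \<bullet> incr X s t \<omega>)) = exp (of_real (rect_area s t) * \<psi> z)"
  using exponent unfolding TPLP_exponent_def by blast

lemma charfun_increments:
  fixes I :: "nat set"
  assumes I: "finite I" and rect: "\<And>i. i \<in> I \<Longrightarrow> is_rect (S i) (T i)"
    and disj: "\<And>i j. i \<in> I \<Longrightarrow> j \<in> I \<Longrightarrow> i \<noteq> j \<Longrightarrow> rect_set (S i) (T i) \<inter> rect_set (S j) (T j) = {}"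
  shows "expectation (\<lambda>\<omega>. cis (\<Sum>i\<in>I. w i \<bullet> incr X (S i) (T i) \<omega>)) =
    (\<Prod>i\<in>I. exp (of_real (rect_area (S i) (T i)) * \<psi> (w i)))"
proof -
  have "\<forall>(I::nat set) S T. finite I \<longrightarrow> (\<forall>i\<in>I. is_rect (S i) (T i)) \<longrightarrow>
        (\<forall>i\<in>I. \<forall>j\<in>I. i \<noteq> j \<longrightarrow> rect_set (S i) (T i) \<inter> rect_set (S j) (T j) = {}) \<longrightarrow>
        indep_vars (\<lambda>_. borel) (\<lambda>i. incr X (S i) (T i)) I"
    using TPLP unfolding TPLP_def by (elim conjE)
  then have "indep_vars (\<lambda>_. borel) (\<lambda>i. incr X (S i) (T i)) I"
    using I rect disj by simp
  then have ind: "indep_vars (\<lambda>_. borel) (\<lambda>i \<omega>. cis (w i \<bullet> incr X (S i) (T i) \<omega>)) I"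
    by (rule indep_vars_compose2) simp
  have "expectation (\<lambda>\<omega>. \<Prod>i\<in>I. cis (w i \<bullet> incr X (S i) (T i) \<omega>)) =
      (\<Prod>i\<in>I. expectation (\<lambda>\<omega>. cis (w i \<bullet> incr X (S i) (T i) \<omega>)))"
    by (rule indep_vars_lebesgue_integral[OF I ind]) (auto intro!: integrable_bounded_by_1)
  also have "\<dots> = (\<Prod>i\<in>I. exp (of_real (rect_area (S i) (T i)) * \<psi> (w i)))"
    by (intro prod.cong refl charfun_rect rect)
  finally show ?thesis by (simp add: cis_sum[OF I])
qed

lemma charfun_point:
  assumes "0 \<le> a" "0 \<le> b"
  shows "expectation (\<lambda>\<omega>. cis (z \<bullet> X (a, b) \<omega>)) = exp (of_real (a * b) * \<psi> z)"
proof -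
  have "expectation (\<lambda>\<omega>. cis (z \<bullet> X (a, b) \<omega>)) = expectation (\<lambda>\<omega>. cis (z \<bullet> incr X (0, 0) (a, b) \<omega>))"
  proof (rule integral_cong_AE)
    show "AE \<omega> in M. cis (z \<bullet> X (a, b) \<omega>) = cis (z \<bullet> incr X (0, 0) (a, b) \<omega>)"
      using AE_axes by eventually_elim (use assms in \<open>simp add: incr_def\<close>)
  qed measurable
  also have "\<dots> = exp (of_real (a * b) * \<psi> z)"
    using assms by (subst charfun_rect) (auto simp: is_rect_def rect_area_def quad_def)
  finally show ?thesis .
qed

text \<open>The points \<open>(1, r)\<close> realise every area \<open>r \<ge> 0\<close>, as
  \<open>exp_scaleR_inject\<close> requires.\<close>

lemma exponent_minus: "\<psi> (- z) = cnj (\<psi> z)"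
proof (rule exp_scaleR_inject)
  fix r :: real assume r: "0 \<le> r"
  have "exp (of_real r * \<psi> (- z)) = expectation (\<lambda>\<omega>. cis (- z \<bullet> X (1, r) \<omega>))"
    using charfun_point[of 1 r "- z"] r by simp
  also have "\<dots> = expectation (\<lambda>\<omega>. cnj (cis (z \<bullet> X (1, r) \<omega>)))" by (simp add: cis_cnj)
  also have "\<dots> = cnj (exp (of_real r * \<psi> z))"
    using charfun_point[of 1 r z] r by simp
  finally show "exp (of_real r * \<psi> (- z)) = exp (of_real r * cnj (\<psi> z))" by (simp add: exp_cnj)
qed

lemma charfun_decreasing_step:
  assumes "0 \<le> x0" "x0 \<le> x1" "0 \<le> y1" "y1 \<le> y0"
  shows "expectation (\<lambda>\<omega>. cis (z \<bullet> (X (x1, y1) \<omega> - X (x0, y0) \<omega>))) =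
    exp (of_real (y1 * (x1 - x0)) * \<psi> z + of_real (x0 * (y0 - y1)) * \<psi> (- z))"
proof -
  \<comment> \<open>Index 0 is the rectangle gained to the right of \<open>x0\<close> and below
    \<open>y1\<close>, index 1 the one lost to the left of \<open>x0\<close> and above
    \<open>y1\<close>. The minus sign of the second goes into the frequency
    \<open>w\<close>.\<close>
  define S where "S = (\<lambda>i::nat. if i = 0 then (x0, 0) else (0, y1))"
  define T where "T = (\<lambda>i::nat. if i = 0 then (x1, y1) else (x0, y0))"
  define w where "w = (\<lambda>i::nat. if i = 0 then z else - z)"
  have "expectation (\<lambda>\<omega>. cis (z \<bullet> (X (x1, y1) \<omega> - X (x0, y0) \<omega>))) =
      expectation (\<lambda>\<omega>. cis (\<Sum>i\<in>{0, 1}. w i \<bullet> incr X (S i) (T i) \<omega>))"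
  proof (rule integral_cong_AE)
    show "AE \<omega> in M. cis (z \<bullet> (X (x1, y1) \<omega> - X (x0, y0) \<omega>)) =
        cis (\<Sum>i\<in>{0, 1}. w i \<bullet> incr X (S i) (T i) \<omega>)"
      using AE_axes by eventually_elim
        (use assms in \<open>simp add: incr_def S_def T_def w_def inner_diff_right inner_add_right\<close>)
  qed measurable
  also have "\<dots> = (\<Prod>i\<in>{0, 1}. exp (of_real (rect_area (S i) (T i)) * \<psi> (w i)))"
    by (rule charfun_increments)
       (use assms in \<open>auto simp: S_def T_def is_rect_def quad_def rect_set_def\<close>)
  also have "\<dots> = exp (of_real (y1 * (x1 - x0)) * \<psi> z + of_real (x0 * (y0 - y1)) * \<psi> (- z))"
    by (simp add: S_def T_def w_def rect_area_def exp_add mult.commute)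
  finally show ?thesis .
qed

text \<open>If \<open>Re \<psi>\<close> vanished identically, the characteristic function of
  \<open>X (1, 1)\<close> would have modulus 1 everywhere, so each
  \<open>cis (z \<bullet> X (1, 1) \<omega>)\<close> would be almost surely constant, and with them
  \<open>X (1, 1)\<close>.\<close>

lemma nondeterministic_imp_Re_exponent:
  assumes "nondeterministic M X"
  obtains z where "Re (\<psi> z) \<noteq> 0"
proof (rule ccontr)
  assume "\<not> thesis"
  then have Re0: "Re (\<psi> z) = 0" for z using that by blast
  define Y where "Y = X (1, 1)"
  have [measurable]: "Y \<in> borel_measurable M" by (simp add: Y_def)
  have const: "AE \<omega> in M. cis (z \<bullet> Y \<omega>) = expectation (\<lambda>\<omega>. cis (z \<bullet> Y \<omega>))" for z
  proof (rule AE_const_if_norm_expectation_1)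
    have "expectation (\<lambda>\<omega>. cis (z \<bullet> Y \<omega>)) = exp (\<psi> z)" using charfun_point[of 1 1 z] by (simp add: Y_def)
    then show "cmod (expectation (\<lambda>\<omega>. cis (z \<bullet> Y \<omega>))) = 1" using Re0 by simp
  qed auto
  \<comment> \<open>The chosen frequencies are countably many, so the null sets can be combined.
    They are also small enough to separate points: a coordinate difference \<open>d\<close> yields a
    phase below 1 once \<open>n\<close> exceeds its absolute value.\<close>
  define good where "good = (\<lambda>\<omega>. \<forall>n. \<forall>b\<in>Basis. cis ((b /\<^sub>R real (Suc n)) \<bullet> Y \<omega>) =
      expectation (\<lambda>\<omega>. cis ((b /\<^sub>R real (Suc n)) \<bullet> Y \<omega>)))"
  have AE_good: "AE \<omega> in M. good \<omega>"
    unfolding good_def AE_all_countable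
  proof
    fix n show "AE \<omega> in M. \<forall>b\<in>Basis. cis ((b /\<^sub>R real (Suc n)) \<bullet> Y \<omega>) =
        expectation (\<lambda>\<omega>. cis ((b /\<^sub>R real (Suc n)) \<bullet> Y \<omega>))"
      by (rule AE_finite_allI[OF finite_Basis const])
  qed
  have "\<exists>\<omega>. good \<omega>"
  proof (rule ccontr)
    assume "\<nexists>\<omega>. good \<omega>"
    then have "AE \<omega> in M. False" using AE_good by simp
    then show False by simp
  qed
  then obtain \<omega>0 where \<omega>0: "good \<omega>0" by blast
  have "Y \<omega> = Y \<omega>0" if \<omega>: "good \<omega>" for \<omega>
  proof (rule euclidean_eqI)
    fix b :: 'v assume b: "b \<in> Basis"
    define d where "d = Y \<omega> \<bullet> b - Y \<omega>0 \<bullet> b"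
    obtain n where n: "\<bar>d\<bar> < real n" using reals_Archimedean2 by blast
    have "cis ((b /\<^sub>R real (Suc n)) \<bullet> Y \<omega>) = cis ((b /\<^sub>R real (Suc n)) \<bullet> Y \<omega>0)"
      using \<omega> \<omega>0 b unfolding good_def by metis
    then have "cis ((b /\<^sub>R real (Suc n)) \<bullet> Y \<omega> - (b /\<^sub>R real (Suc n)) \<bullet> Y \<omega>0) = 1"
      by (simp only: cis_divide[symmetric]) simp
    moreover have "(b /\<^sub>R real (Suc n)) \<bullet> Y \<omega> - (b /\<^sub>R real (Suc n)) \<bullet> Y \<omega>0 = d / real (Suc n)"
      by (simp add: d_def inner_commute divide_inverse algebra_simps)
    ultimately have "cis (d / real (Suc n)) = 1" by simp
    moreover have "\<bar>d / real (Suc n)\<bar> < 1" using n by (simp add: abs_divide)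
    ultimately have "d / real (Suc n) = 0" by (rule cis_eq_1_small)
    then show "Y \<omega> \<bullet> b = Y \<omega>0 \<bullet> b" by (simp add: d_def)
  qed
  then have "AE \<omega> in M. X (1, 1) \<omega> = Y \<omega>0"
    using AE_good by (auto simp: Y_def elim: eventually_mono)
  then show False using assms by (auto simp: nondeterministic_def)
qed

text \<open>Almost surely, each \<open>X t\<close> is the sum of the cells below \<open>t\<close> in
  a common grid, so the joint characteristic function is a product over cells of exponentials of
  \<open>\<psi>\<close> at summed frequencies. Negating all frequencies negates these sums, and
  \<open>\<psi>\<close> is even.\<close>

lemma charfun_fdd_uminus:
  assumes sym: "\<And>z. \<psi> (- z) = \<psi> z" and F: "finite F" "F \<subseteq> quad"
  shows "expectation (\<lambda>\<omega>. cis (\<Sum>t\<in>F. z t \<bullet> X t \<omega>)) = expectation (\<lambda>\<omega>. cis (\<Sum>t\<in>F. z t \<bullet> - X t \<omega>))"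
proof -
  have "\<exists>(g::nat \<Rightarrow> real) n. mono g \<and> g 0 = 0 \<and> fst ` F \<subseteq> g ` {..n} \<and> range g \<subseteq> insert 0 (fst ` F)"
    by (rule finite_set_in_grid) (use F in \<open>auto simp: quad_def\<close>)
  then obtain g :: "nat \<Rightarrow> real" and m where g: "mono g" "g 0 = 0" "fst ` F \<subseteq> g ` {..m}" by blast
  have "\<exists>(g::nat \<Rightarrow> real) n. mono g \<and> g 0 = 0 \<and> snd ` F \<subseteq> g ` {..n} \<and> range g \<subseteq> insert 0 (snd ` F)"
    by (rule finite_set_in_grid) (use F in \<open>auto simp: quad_def\<close>)
  then obtain h :: "nat \<Rightarrow> real" and n where h: "mono h" "h 0 = 0" "snd ` F \<subseteq> h ` {..n}" by blast
  have gh0: "0 \<le> g i" "0 \<le> h i" for i using monoD[OF g(1), of 0 i] monoD[OF h(1), of 0 i] g h by auto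
  have "\<forall>t\<in>F. \<exists>i\<le>m. g i = fst t" "\<forall>t\<in>F. \<exists>j\<le>n. h j = snd t" using g(3) h(3) by force+
  then obtain a b where a: "\<And>t. t \<in> F \<Longrightarrow> a t \<le> m \<and> g (a t) = fst t"
    and b: "\<And>t. t \<in> F \<Longrightarrow> b t \<le> n \<and> h (b t) = snd t" by metis
  define cell where "cell = (\<lambda>p. incr X (g (fst p), h (snd p)) (g (Suc (fst p)), h (Suc (snd p))))"
  define C where "C = {..<m} \<times> {..<n}"
  \<comment> \<open>The frequency collected by the cell \<open>p\<close>: the sum of
    \<open>z t\<close> over those \<open>t\<close> whose rectangle from the origin contains the
    cell.\<close>
  define W where "W = (\<lambda>(z :: real \<times> real \<Rightarrow> 'v) p. \<Sum>t\<in>F. of_bool (fst p < a t \<and> snd p < b t) *\<^sub>R z t)"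
  \<comment> \<open>Independence in \<open>TPLP\<close> is stated for families indexed by naturals,
    so cells are numbered by the pairing function.\<close>
  define I where "I = prod_encode ` C"
  define S where "S = (\<lambda>k. (g (fst (prod_decode k)), h (snd (prod_decode k))))"
  define T where "T = (\<lambda>k. (g (Suc (fst (prod_decode k))), h (Suc (snd (prod_decode k)))))"
  have "finite C" by (simp add: C_def)
  have X_cells: "AE \<omega> in M. \<forall>t\<in>F. X t \<omega> = (\<Sum>p\<in>C. of_bool (fst p < a t \<and> snd p < b t) *\<^sub>R cell p \<omega>)"
    using AE_axes
  proof eventually_elim
    case (elim \<omega>)
    show ?case
    proof
      fix t assume t: "t \<in> F"
      have "(\<Sum>p\<in>C. of_bool (fst p < a t \<and> snd p < b t) *\<^sub>R cell p \<omega>) = (\<Sum>p\<in>{..<a t} \<times> {..<b t}. cell p \<omega>)"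
        using a[OF t] b[OF t] \<open>finite C\<close>
        by (intro sum.mono_neutral_cong_right) (auto simp: C_def)
      also have "\<dots> = (\<Sum>i<a t. \<Sum>j<b t. incr X (g i, h j) (g (Suc i), h (Suc j)) \<omega>)"
        by (simp add: cell_def sum.cartesian_product split_def)
      also have "\<dots> = X t \<omega>"
        unfolding sum_grid_cells using elim a[OF t] b[OF t] g(2) h(2) gh0(1)[of "a t"] gh0(2)[of "b t"]
        by simp
      finally show "X t \<omega> = (\<Sum>p\<in>C. of_bool (fst p < a t \<and> snd p < b t) *\<^sub>R cell p \<omega>)" by simp
    qed
  qed
  have cf: "expectation (\<lambda>\<omega>. cis (\<Sum>t\<in>F. z t \<bullet> X t \<omega>)) =
      (\<Prod>k\<in>I. exp (of_real (rect_area (S k) (T k)) * \<psi> (W z (prod_decode k))))" for z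
  proof -
    have "expectation (\<lambda>\<omega>. cis (\<Sum>t\<in>F. z t \<bullet> X t \<omega>)) =
        expectation (\<lambda>\<omega>. cis (\<Sum>k\<in>I. W z (prod_decode k) \<bullet> incr X (S k) (T k) \<omega>))"
    proof (rule integral_cong_AE)
      show "AE \<omega> in M. cis (\<Sum>t\<in>F. z t \<bullet> X t \<omega>) = cis (\<Sum>k\<in>I. W z (prod_decode k) \<bullet> incr X (S k) (T k) \<omega>)"
        using X_cells
      proof eventually_elim
        case (elim \<omega>)
        have "(\<Sum>t\<in>F. z t \<bullet> X t \<omega>) = (\<Sum>t\<in>F. \<Sum>p\<in>C. (of_bool (fst p < a t \<and> snd p < b t) *\<^sub>R z t) \<bullet> cell p \<omega>)"
          using elim by (intro sum.cong) (simp_all add: inner_sum_right)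
        also have "\<dots> = (\<Sum>p\<in>C. W z p \<bullet> cell p \<omega>)"
          unfolding W_def inner_sum_left by (rule sum.swap)
        also have "\<dots> = (\<Sum>k\<in>I. W z (prod_decode k) \<bullet> incr X (S k) (T k) \<omega>)"
          unfolding I_def by (subst sum.reindex) (auto simp: inj_prod_encode cell_def S_def T_def)
        finally show ?case by simp
      qed
    qed measurable
    also have "\<dots> = (\<Prod>k\<in>I. exp (of_real (rect_area (S k) (T k)) * \<psi> (W z (prod_decode k))))"
    proof (rule charfun_increments)
      show "finite I" using \<open>finite C\<close> by (simp add: I_def)
      show "is_rect (S k) (T k)" for k
        using monoD[OF g(1), of _ "Suc _"] monoD[OF h(1), of _ "Suc _"] gh0
        by (simp add: is_rect_def quad_def S_def T_def)
      show "rect_set (S k) (T k) \<inter> rect_set (S k') (T k') = {}" if "k \<noteq> k'" for k k'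
      proof -
        have "prod_decode k \<noteq> prod_decode k'" using that inj_prod_decode[of UNIV] by (simp add: inj_eq)
        then show ?thesis unfolding S_def T_def
          by (intro grid_cells_disjoint[OF g(1) h(1)]) (simp add: prod_eq_iff)
      qed
    qed
    finally show ?thesis .
  qed
  have "W (\<lambda>t. - z t) p = - W z p" for p by (simp add: W_def sum_negf)
  then show ?thesis using cf[of z] cf[of "\<lambda>t. - z t"] sym by simp
qed

text \<open>In one direction, project to the points \<open>(1, r)\<close>. In the other, the
  finite-dimensional laws of \<open>X\<close> and \<open>- X\<close> agree by
  \<open>charfun_joint\<close>, and cylinder sets determine a finite measure on the product
  space.\<close>

theorem symmetric_iff_exponent: "symmetric_proc M X \<longleftrightarrow> (\<forall>z. \<psi> (- z) = \<psi> z)"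
proof
  have meas: "(\<lambda>\<omega>. \<lambda>t\<in>quad. X t \<omega>) \<in> measurable M (Pi\<^sub>M quad (\<lambda>_. borel))"
    "(\<lambda>\<omega>. \<lambda>t\<in>quad. - X t \<omega>) \<in> measurable M (Pi\<^sub>M quad (\<lambda>_. borel))"
    by measurable
  show "\<forall>z. \<psi> (- z) = \<psi> z" if sym: "symmetric_proc M X"
  proof (rule allI, rule exp_scaleR_inject)
    fix z and r :: real assume r: "0 \<le> r"
    then have t: "(1, r) \<in> quad" by (simp add: quad_def)
    have "distr (distr M (Pi\<^sub>M quad (\<lambda>_. borel)) (\<lambda>\<omega>. \<lambda>t\<in>quad. X t \<omega>)) borel (\<lambda>f. f (1, r)) =
        distr (distr M (Pi\<^sub>M quad (\<lambda>_. borel)) (\<lambda>\<omega>. \<lambda>t\<in>quad. - X t \<omega>)) borel (\<lambda>f. f (1, r))"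
      by (rule arg_cong[OF sym[unfolded symmetric_proc_def]])
    then have "distr M borel (X (1, r)) = distr M borel (\<lambda>\<omega>. - X (1, r) \<omega>)"
      by (subst (asm) (1 2) distr_distr[OF measurable_component_singleton[OF t]]) (simp_all add: meas comp_def t)
    then have "expectation (\<lambda>\<omega>. cis (z \<bullet> X (1, r) \<omega>)) = expectation (\<lambda>\<omega>. cis (z \<bullet> - X (1, r) \<omega>))"
      by (subst (asm) distr_eq_iff_charfun) (auto intro: prob_space_axioms)
    then show "exp (of_real r * \<psi> (- z)) = exp (of_real r * \<psi> z)"
      using charfun_point[of 1 r z] charfun_point[of 1 r "- z"] r by simp
  qed
  show "symmetric_proc M X" if sym: "\<forall>z. \<psi> (- z) = \<psi> z"
    unfolding symmetric_proc_def
  proof (rule measure_eqI_PiM_infinite)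
    fix A :: "real \<times> real \<Rightarrow> 'v set" and J
    assume J: "finite J" "J \<subseteq> quad" and A: "\<And>t. t \<in> J \<Longrightarrow> A t \<in> sets borel"
    have eq: "measure M {\<omega> \<in> space M. \<forall>t\<in>J. X t \<omega> \<in> A t} = measure M {\<omega> \<in> space M. \<forall>t\<in>J. - X t \<omega> \<in> A t}"
      by (rule charfun_joint[OF charfun_determines prob_space_axioms prob_space_axioms J(1)])
         (use A charfun_fdd_uminus[OF _ J] sym in auto)
    have emb: "emeasure (distr M (Pi\<^sub>M quad (\<lambda>_. borel)) (\<lambda>\<omega>. \<lambda>t\<in>quad. Y t \<omega>))
        (prod_emb quad (\<lambda>_. borel) J (Pi\<^sub>E J A)) = emeasure M {\<omega> \<in> space M. \<forall>t\<in>J. Y t \<omega> \<in> A t}"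
      if [measurable]: "\<And>t. Y t \<in> borel_measurable M" for Y :: "real \<times> real \<Rightarrow> 'a \<Rightarrow> 'v"
    proof -
      have "(\<lambda>\<omega>. \<lambda>t\<in>quad. Y t \<omega>) -` (prod_emb quad (\<lambda>_. borel) J (Pi\<^sub>E J A)) \<inter> space M =
          {\<omega> \<in> space M. \<forall>t\<in>J. Y t \<omega> \<in> A t}"
        using J by (auto simp: prod_emb_def PiE_iff subset_eq)
      moreover have "prod_emb quad (\<lambda>_. borel) J (Pi\<^sub>E J A) \<in> sets (Pi\<^sub>M quad (\<lambda>_. borel))"
        using J A by (intro sets_PiM_I) auto
      moreover have "(\<lambda>\<omega>. \<lambda>t\<in>quad. Y t \<omega>) \<in> measurable M (Pi\<^sub>M quad (\<lambda>_. borel))" by measurable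
      ultimately show ?thesis by (simp add: emeasure_distr)
    qed
    show "emeasure (distr M (Pi\<^sub>M quad (\<lambda>_. borel)) (\<lambda>\<omega>. \<lambda>t\<in>quad. X t \<omega>)) (prod_emb quad (\<lambda>_. borel) J (Pi\<^sub>E J A)) =
        emeasure (distr M (Pi\<^sub>M quad (\<lambda>_. borel)) (\<lambda>\<omega>. \<lambda>t\<in>quad. - X t \<omega>)) (prod_emb quad (\<lambda>_. borel) J (Pi\<^sub>E J A))"
      using eq by (simp add: emb[of X] emb[of "\<lambda>t \<omega>. - X t \<omega>"] emeasure_eq_measure)
  next
    show "finite_measure (distr M (Pi\<^sub>M quad (\<lambda>_. borel)) (\<lambda>\<omega>. \<lambda>t\<in>quad. X t \<omega>))"
      using prob_space_distr[OF meas(1)] by (rule prob_space.finite_measure)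
  qed simp_all
qed

end

section \<open>Increments along a decreasing path and their stationarity\<close>

context tplp begin

text \<open>This form puts the rate into the modulus and the area gain into the phase, so the two
  can be treated separately.\<close>

lemma incr_charfun_path:
  assumes path: "decreasing_path T x y" and st: "s \<in> T" "t \<in> T" "s < t"
  shows "incr_charfun M X x y s t z =
    exp (Complex (path_rate x y s t * Re (\<psi> z)) (path_area_gain x y s t * Im (\<psi> z)))"
proof -
  have "x s \<le> x t" "y t \<le> y s"
    using path st by (auto simp: decreasing_path_def monotone_on_def)
  then have "incr_charfun M X x y s t z =
      exp (of_real (y t * (x t - x s)) * \<psi> z + of_real (x s * (y s - y t)) * cnj (\<psi> z))"
    using decreasing_path_nonneg[OF path] st
    by (simp add: incr_charfun_def charfun_decreasing_step exponent_minus)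
  also have "of_real (y t * (x t - x s)) * \<psi> z + of_real (x s * (y s - y t)) * cnj (\<psi> z) =
      Complex (path_rate x y s t * Re (\<psi> z)) (path_area_gain x y s t * Im (\<psi> z))"
    by (simp add: complex_eq_iff path_rate_def path_area_gain_def algebra_simps)
  finally show ?thesis .
qed

lemma stationary_iff_charfun:
  "stationary_increments_along M X T x y \<longleftrightarrow> (\<forall>z. shift_invariant_on T (\<lambda>s t. incr_charfun M X x y s t z))"
proof -
  have "distr M borel (\<lambda>\<omega>. X (x t, y t) \<omega> - X (x s, y s) \<omega>) = distr M borel (\<lambda>\<omega>. X (x t', y t') \<omega> - X (x s', y s') \<omega>)
      \<longleftrightarrow> (\<forall>z. incr_charfun M X x y s t z = incr_charfun M X x y s' t' z)" for s t s' t'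
    unfolding incr_charfun_def by (rule distr_eq_iff_charfun[OF prob_space_axioms]) measurable
  then show ?thesis unfolding stationary_increments_along_def shift_invariant_on_def by blast
qed

text \<open>The phase of the characteristic function is only determined modulo \<open>2\<pi>\<close>. If the area gain were
  to vary under shifts, it would vary continuously, so that all small phases would occur.\<close>

lemma area_gain_shift_invariant:
  assumes path: "decreasing_path T x y" and z: "Im (\<psi> z) \<noteq> 0"
    and rate: "shift_invariant_on T (path_rate x y)"
    and cf: "shift_invariant_on T (\<lambda>s t. incr_charfun M X x y s t z)"
  shows "shift_invariant_on T (path_area_gain x y)"
proof -
  have I: "is_interval T" and cont: "continuous_on T x" "continuous_on T y"
    using path by (auto simp: decreasing_path_def)
  have eq: "path_area_gain x y s t = path_area_gain x y s' t'"
    if st: "s \<in> T" "t \<in> T" "s' \<in> T" "t' \<in> T" "s < t" "s \<le> s'" "t - s = t' - s'" for s t s' t'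
  proof (rule ccontr)
    assume ne: "path_area_gain x y s t \<noteq> path_area_gain x y s' t'"
    define u where "u = t - s"
    have u: "0 < u" "t = s + u" "t' = s' + u" using st by (auto simp: u_def)
    define \<delta> where "\<delta> = (\<lambda>r. \<bar>path_area_gain x y r (r + u) - path_area_gain x y s t\<bar>)"
    have inT: "r \<in> T" "r + u \<in> T" if "r \<in> {s..s'}" for r
      using mem_is_interval_1_I[OF I st(1,3), of r] mem_is_interval_1_I[OF I st(2,4), of "r + u"] that u by auto
    have shifted: "continuous_on {s..s'} (\<lambda>r. f (r + u))" "continuous_on {s..s'} f" if "continuous_on T f" for f :: "real \<Rightarrow> real"
    proof -
      have "continuous_on {s..s'} (f \<circ> (\<lambda>r. r + u))"
        by (rule continuous_on_compose) (auto intro!: continuous_intros continuous_on_subset[OF that] dest: inT simp del: image_add_atLeastAtMost')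
      then show "continuous_on {s..s'} (\<lambda>r. f (r + u))" by (simp add: comp_def)
      show "continuous_on {s..s'} f" by (rule continuous_on_subset[OF that]) (use inT in auto)
    qed
    have "continuous_on {s..s'} \<delta>" unfolding \<delta>_def path_area_gain_def
      by (intro continuous_intros shifted cont)
    \<comment> \<open>A value that the continuous \<open>\<delta>\<close> attains between
      \<open>s\<close> and \<open>s'\<close>: positive, yet so small that the phase difference is at
      most \<open>1 / 2\<close> and cannot be a nonzero multiple of \<open>2 * pi\<close>.\<close>
    moreover define v where "v = min (\<delta> s') (1 / (2 * \<bar>Im (\<psi> z)\<bar>))"
    have v: "0 < v" "v \<le> \<delta> s'" "v \<le> 1 / (2 * \<bar>Im (\<psi> z)\<bar>)" using ne z u by (auto simp: v_def \<delta>_def)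
    moreover have "\<delta> s = 0" by (simp add: \<delta>_def u)
    ultimately obtain r where r: "s \<le> r" "r \<le> s'" "\<delta> r = v"
      using IVT'[of \<delta> s v s'] st by auto
    define \<theta> where "\<theta> = (path_area_gain x y r (r + u) - path_area_gain x y s t) * Im (\<psi> z)"
    have rT: "r \<in> T" "r + u \<in> T" using inT r by auto
    have "incr_charfun M X x y r (r + u) z = incr_charfun M X x y s t z"
      by (rule shift_invariant_onD[OF cf]) (use rT st u in auto)
    moreover have "path_rate x y r (r + u) = path_rate x y s t"
      by (rule shift_invariant_onD[OF rate]) (use rT st u in auto)
    ultimately have "cis (path_area_gain x y r (r + u) * Im (\<psi> z)) = cis (path_area_gain x y s t * Im (\<psi> z))"
      using rT st u by (simp add: incr_charfun_path[OF path] exp_eq_polar)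
    then have "cis \<theta> = 1" by (simp add: \<theta>_def left_diff_distrib cis_divide[symmetric])
    moreover have "\<bar>\<theta>\<bar> = v * \<bar>Im (\<psi> z)\<bar>" using r(3) by (simp add: \<theta>_def \<delta>_def abs_mult)
    moreover have "v * \<bar>Im (\<psi> z)\<bar> < 1"
    proof -
      have "v * \<bar>Im (\<psi> z)\<bar> \<le> 1 / (2 * \<bar>Im (\<psi> z)\<bar>) * \<bar>Im (\<psi> z)\<bar>" by (intro mult_right_mono v) simp
      then show ?thesis using z by simp
    qed
    ultimately have "\<theta> = 0" by (intro cis_eq_1_small) auto
    then show False using \<open>\<bar>\<theta>\<bar> = v * \<bar>Im (\<psi> z)\<bar>\<close> v(1) z by simp
  qed
  show ?thesis unfolding shift_invariant_on_def
  proof (intro ballI impI)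
    fix s t s' t' assume st: "s \<in> T" "t \<in> T" "s' \<in> T" "t' \<in> T" "s < t" "s' < t'" "t - s = t' - s'"
    show "path_area_gain x y s t = path_area_gain x y s' t'"
    proof (cases "s \<le> s'")
      case True
      then show ?thesis by (intro eq st)
    next
      case False
      then have "path_area_gain x y s' t' = path_area_gain x y s t" by (intro eq) (use st in auto)
      then show ?thesis ..
    qed
  qed
qed

text \<open>Where \<open>Re (\<psi> z0) \<noteq> 0\<close>, the modulus determines the rate. Once
  the rate is shift-invariant, a single \<open>z\<close> with
  \<open>Im (\<psi> z) \<noteq> 0\<close> makes the area gain so too; without such a
  \<open>z\<close> all phases are zero.\<close>

lemma stationary_iff_shift_invariant:
  assumes path: "decreasing_path T x y" and nd: "nondeterministic M X"
  shows "stationary_increments_along M X T x y \<longleftrightarrow> shift_invariant_on T (path_rate x y) \<and>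
    ((\<forall>z. Im (\<psi> z) = 0) \<or> shift_invariant_on T (path_area_gain x y))"
proof
  assume "stationary_increments_along M X T x y"
  then have cf: "shift_invariant_on T (\<lambda>s t. incr_charfun M X x y s t z)" for z
    by (simp add: stationary_iff_charfun)
  obtain z0 where z0: "Re (\<psi> z0) \<noteq> 0" using nondeterministic_imp_Re_exponent[OF nd] .
  have rate: "shift_invariant_on T (path_rate x y)" unfolding shift_invariant_on_def
  proof (intro ballI impI)
    fix s t s' t' assume st: "s \<in> T" "t \<in> T" "s' \<in> T" "t' \<in> T" "s < t" "s' < t'" "t - s = t' - s'"
    have "cmod (incr_charfun M X x y s t z0) = cmod (incr_charfun M X x y s' t' z0)"
      using shift_invariant_onD[OF cf st] by simp
    then show "path_rate x y s t = path_rate x y s' t'"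
      using z0 by (simp add: incr_charfun_path[OF path] st)
  qed
  then show "shift_invariant_on T (path_rate x y) \<and>
    ((\<forall>z. Im (\<psi> z) = 0) \<or> shift_invariant_on T (path_area_gain x y))"
    using area_gain_shift_invariant[OF path _ rate cf] by blast
next
  assume inv: "shift_invariant_on T (path_rate x y) \<and>
    ((\<forall>z. Im (\<psi> z) = 0) \<or> shift_invariant_on T (path_area_gain x y))"
  show "stationary_increments_along M X T x y"
    unfolding stationary_iff_charfun shift_invariant_on_def
  proof (intro allI ballI impI)
    fix z s t s' t' assume st: "s \<in> T" "t \<in> T" "s' \<in> T" "t' \<in> T" "s < t" "s' < t'" "t - s = t' - s'"
    have "path_rate x y s t = path_rate x y s' t'"
      "Im (\<psi> z) = 0 \<or> path_area_gain x y s t = path_area_gain x y s' t'"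
      using inv shift_invariant_onD[OF _ st] by blast+
    then show "incr_charfun M X x y s t z = incr_charfun M X x y s' t' z"
      using st by (auto simp: incr_charfun_path[OF path])
  qed
qed

lemma symmetric_iff_Im_exponent: "symmetric_proc M X \<longleftrightarrow> (\<forall>z. Im (\<psi> z) = 0)"
  unfolding symmetric_iff_exponent exponent_minus by (auto simp: complex_eq_iff)

lemma incr_charfun_symmetric:
  assumes "symmetric_proc M X" "decreasing_path T x y" "s \<in> T" "t \<in> T" "s < t"
  shows "incr_charfun M X x y s t z = exp (of_real (path_rate x y s t) * \<psi> z)"
proof -
  have "Complex (path_rate x y s t * Re (\<psi> z)) (path_area_gain x y s t * Im (\<psi> z)) = of_real (path_rate x y s t) * \<psi> z"
    using assms(1) by (simp add: complex_eq_iff symmetric_iff_Im_exponent)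
  then show ?thesis using incr_charfun_path[OF assms(2-)] by simp
qed

text \<open>Along (iv) the product \<open>x * y\<close> is constant, so the area gain is zero and
  only \<open>Re (\<psi> z)\<close> survives, which is the mean of \<open>\<psi> z\<close> and
  \<open>\<psi> (- z)\<close>.\<close>

lemma incr_charfun_cond_iv:
  assumes "cond_iv T x y a b c" "decreasing_path T x y" "s \<in> T" "t \<in> T" "s < t"
  shows "incr_charfun M X x y s t z = exp (of_real (phi_iv a b c (t - s)) * ((\<psi> z + \<psi> (- z)) / 2))"
proof -
  have "Complex (path_rate x y s t * Re (\<psi> z)) (path_area_gain x y s t * Im (\<psi> z)) =
      of_real (phi_iv a b c (t - s)) * ((\<psi> z + \<psi> (- z)) / 2)"
    using path_rate_cond_iv[OF assms(1,3,4)] path_area_gain_cond_iv[OF assms(1,3,4)]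
    by (simp add: complex_eq_iff exponent_minus)
  then show ?thesis by (simp only: incr_charfun_path[OF assms(2-)])
qed

end

theorem theorem2:
  fixes M :: "'a measure" and X :: "real \<times> real \<Rightarrow> 'a \<Rightarrow> 'v::euclidean_space"
    and \<psi> :: "'v \<Rightarrow> complex" and T :: "real set" and x y :: "real \<Rightarrow> real"
  assumes "TPLP M X" and "TPLP_exponent M X \<psi>" and "nondeterministic M X"
    and "decreasing_path T x y"
  shows "(symmetric_proc M X \<longrightarrow>
           (stationary_increments_along M X T x y \<longleftrightarrow>
              (\<exists>a b c. cond_i T x y a b c) \<or> (\<exists>s0 a b c d. cond_ii T x y s0 a b c d) \<or>
              (\<exists>a b c d. cond_iii T x y a b c d) \<or> (\<exists>a b c. cond_iv T x y a b c)) \<and>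
           (\<forall>a b c. cond_i T x y a b c \<longrightarrow> (\<forall>z. \<forall>s\<in>T. \<forall>t\<in>T. s < t \<longrightarrow>
              incr_charfun M X x y s t z = exp (complex_of_real (phi_i a c (t - s)) * \<psi> z))) \<and>
           (\<forall>s0 a b c d. cond_ii T x y s0 a b c d \<longrightarrow> (\<forall>z. \<forall>s\<in>T. \<forall>t\<in>T. s < t \<longrightarrow>
              incr_charfun M X x y s t z = exp (complex_of_real (phi_ii a c (t - s)) * \<psi> z))) \<and>
           (\<forall>a b c d. cond_iii T x y a b c d \<longrightarrow> (\<forall>z. \<forall>s\<in>T. \<forall>t\<in>T. s < t \<longrightarrow>
              incr_charfun M X x y s t z = exp (complex_of_real (phi_iii a b c d (t - s)) * \<psi> z))) \<and>
           (\<forall>a b c. cond_iv T x y a b c \<longrightarrow> (\<forall>z. \<forall>s\<in>T. \<forall>t\<in>T. s < t \<longrightarrow>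
              incr_charfun M X x y s t z = exp (complex_of_real (phi_iv a b c (t - s)) * \<psi> z))))
       \<and> (\<not> symmetric_proc M X \<longrightarrow>
           (stationary_increments_along M X T x y \<longleftrightarrow>
              (\<exists>a b c. cond_i T x y a b c) \<or> (\<exists>a b c. cond_iv T x y a b c)) \<and>
           (\<forall>a b c. cond_iv T x y a b c \<longrightarrow> (\<forall>z. \<forall>s\<in>T. \<forall>t\<in>T. s < t \<longrightarrow>
              incr_charfun M X x y s t z =
                exp (complex_of_real (phi_iv a b c (t - s)) * ((\<psi> z + \<psi> (- z)) / 2)))))"
proof -
  interpret tplp M X \<psi> using assms(1,2) by unfold_locales
  note path = assms(4)
  note stat = stationary_iff_shift_invariant[OF path assms(3)]
  show ?thesis
  proof (intro conjI impI allI ballI)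
    assume sym: "symmetric_proc M X"
    show "stationary_increments_along M X T x y \<longleftrightarrow>
        (\<exists>a b c. cond_i T x y a b c) \<or> (\<exists>s0 a b c d. cond_ii T x y s0 a b c d) \<or>
        (\<exists>a b c d. cond_iii T x y a b c d) \<or> (\<exists>a b c. cond_iv T x y a b c)"
      using sym by (simp only: stat symmetric_iff_Im_exponent shift_invariant_rate_iff[OF path] simp_thms)
    fix s t z assume st: "s \<in> T" "t \<in> T" "s < t"
    note cf = incr_charfun_symmetric[OF sym path st]
    show "incr_charfun M X x y s t z = exp (complex_of_real (phi_i a c (t - s)) * \<psi> z)"
      if "cond_i T x y a b c" for a b c
      using path_rate_cond_i[OF that st(1,2)] cf by simp
    show "incr_charfun M X x y s t z = exp (complex_of_real (phi_ii a c (t - s)) * \<psi> z)"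
      if "cond_ii T x y s0 a b c d" for s0 a b c d
      using path_rate_cond_ii[OF that st] cf by simp
    show "incr_charfun M X x y s t z = exp (complex_of_real (phi_iii a b c d (t - s)) * \<psi> z)"
      if "cond_iii T x y a b c d" for a b c d
      using path_rate_cond_iii[OF that st(1,2)] cf by simp
    show "incr_charfun M X x y s t z = exp (complex_of_real (phi_iv a b c (t - s)) * \<psi> z)"
      if "cond_iv T x y a b c" for a b c
      using path_rate_cond_iv[OF that st(1,2)] cf by simp
  next
    assume nsym: "\<not> symmetric_proc M X"
    then have "stationary_increments_along M X T x y \<longleftrightarrow>
        shift_invariant_on T (path_rate x y) \<and> shift_invariant_on T (path_area_gain x y)"
      unfolding stat symmetric_iff_Im_exponent by blast
    then show "stationary_increments_along M X T x y \<longleftrightarrow>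
        (\<exists>a b c. cond_i T x y a b c) \<or> (\<exists>a b c. cond_iv T x y a b c)"
      by (simp only: shift_invariant_rate_and_gain_iff[OF path])
    show "incr_charfun M X x y s t z = exp (complex_of_real (phi_iv a b c (t - s)) * ((\<psi> z + \<psi> (- z)) / 2))"
      if "cond_iv T x y a b c" "s \<in> T" "t \<in> T" "s < t" for a b c z s t
      by (rule incr_charfun_cond_iv[OF that(1) path that(2-)])
  qed
qed

end
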